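(* Let $H$ be a generalised snake graph, coloured so that all its turns are black, equipped with a Kasteleyn weighting $w$. Let $B$ be the weighted bipartite adjacency matrix of $H$ and let $B_1$ and $B_2$ be the principal submatrices of $BB^T$ indexed by the black vertices on the upper boundary and on the lower boundary, respectively. Then $\lvert\det(B_1)\rvert=\lvert\det(B_2)\rvert$, and this common value equals the number of perfect matchings of $H$.
   Context: A snake graph is a plane graph formed by a finite sequence of unit square tiles $T_1,\dots,T_N$ in the plane, each $T_{i+1}$ placed immediately to the right of or on top of $T_i$, consecutive tiles sharing exactly one edge. Rotation: let $G=(V,E)$ be a bipartite graph with $V=V_0\sqcup V_1\sqcup V_2$ such that the induced subgraph on $V_0$ is a square (4-cycle) with edges $AB,BC,CD,DA$; there are vertices $S_1,\dots,S_n,R_1,\dots,R_m\in V_2$ such that the edges $DS_i$ ($i\in[1,n]$) and $CR_j$ ($j\in[1,m]$) are the only edges joining $V_2$ to $V\setminus V_2$; and the only edges joining $V_1$ to $V\setminus V_1$ join vertices of $V_1$ to $B$ or $C$. The rotation of $G$ at this square is the graph on $V$ obtained by deleting the edges $DS_i, CR_j$ and adding the edges $BS_i, AR_j$. A generalised snake graph is a graph obtained from a snake graph by a finite sequence of rotations at tiles; it is again a sequence of square tiles $T_1,\dots,T_N$ each glued to the previous one along an edge, and it is planar, embedded so that the bounded faces are exactly the tiles. A vertex is a turn if either (i) it is a vertex of at least $3$ tiles, or (ii) it is diagonally opposite across a tile to a vertex as in (i), belongs to exactly one tile, and is not a vertex of $T_1$ or $T_N$. Boundaries: for $N\geq2$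 the start edge is the edge of $T_1$ joining the two vertices of $T_1$ not belonging to any other tile, the end edge is defined analogously for $T_N$; the edges bounding the unbounded face form a cycle, and removing start and end edges leaves two disjoint paths, the upper and lower boundary (the one containing the lower-left vertex of $T_1$ is the upper boundary if the next tile is above $T_1$, otherwise the lower boundary). A weighting $w:E\to\{\pm1\}$ is Kasteleyn if every face (including the unbounded face) bounded by a $k$-cycle has an odd number of edges of weight $-1$ when $k\equiv0\bmod4$ and an even number when $k\equiv2\bmod4$. $B$ has rows indexed by black vertices, columns by white vertices, entry $w(e)$ if joined by edge $e$ and $0$ otherwise. A perfect matching is a set of edges such that every vertex lies in exactly one of them. *)

theory Defs
  imports Complex_Main "Jordan_Normal_Form.Determinant" "Jordan_Normal_Form.DL_Submatrix"
begin

section \<open>Graphs built from square tiles\<close>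

text \<open>The four corners of a tile in counterclockwise order, starting at the lower left. A rotation
  replaces corners but keeps their roles, so that \<^term>\<open>sw\<close> of the first tile remains its lower
  left vertex in the drawing in which that tile keeps its place.\<close>

datatype 'a tile = Tile (sw: 'a) (se: 'a) (ne: 'a) (nw: 'a)

definition tile_edges :: "'a tile \<Rightarrow> 'a set set" where
  "tile_edges t = {{sw t, se t}, {se t, ne t}, {ne t, nw t}, {nw t, sw t}}"

definition opposite_in :: "'a tile \<Rightarrow> 'a \<Rightarrow> 'a \<Rightarrow> bool" where
  "opposite_in t u v \<longleftrightarrow> {u, v} = {sw t, ne t} \<or> {u, v} = {se t, nw t}"

text \<open>Edges are two-element vertex sets. The list of tiles \<open>T\<^sub>1, \<dots>, T\<^sub>N\<close> (indexed from 0) records the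
  plane embedding: the bounded faces are exactly the tiles.\<close>

record 'a tiled_graph =
  verts :: "'a set"
  edges :: "'a set set"
  tiles :: "'a tile list"

definition two_colouring :: "'a tiled_graph \<Rightarrow> 'a set \<Rightarrow> 'a set \<Rightarrow> bool" where
  "two_colouring G Bk Wh \<longleftrightarrow>
     Bk \<union> Wh = verts G \<and> Bk \<inter> Wh = {} \<and> (\<forall>e\<in>edges G. \<exists>b\<in>Bk. \<exists>c\<in>Wh. e = {b, c})"


section \<open>Snake graphs\<close>

definition unit_tile :: "real \<times> real \<Rightarrow> (real \<times> real) tile" where
  "unit_tile p = (case p of (x, y) \<Rightarrow> Tile (x, y) (x + 1, y) (x + 1, y + 1) (x, y + 1))"

text \<open>\<open>ps\<close> lists the lower left corners of the tiles.\<close>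

definition snake_graph :: "(real \<times> real) tiled_graph \<Rightarrow> bool" where
  "snake_graph G \<longleftrightarrow> (\<exists>ps. ps \<noteq> [] \<and>
     (\<forall>i. Suc i < length ps \<longrightarrow>
        ps ! Suc i = (fst (ps ! i) + 1, snd (ps ! i)) \<or>
        ps ! Suc i = (fst (ps ! i), snd (ps ! i) + 1)) \<and>
     tiles G = map unit_tile ps \<and>
     verts G = (\<Union>t\<in>set (tiles G). set_tile t) \<and>
     edges G = (\<Union>t\<in>set (tiles G). tile_edges t))"


section \<open>Rotation at a tile\<close>

text \<open>The vertices \<open>S\<^sub>i\<close> and \<open>R\<^sub>j\<close> are the neighbours in \<open>V2\<close> of \<open>D\<close> and \<open>C\<close>.\<close>

definition rotatable ::
  "'a tiled_graph \<Rightarrow> 'a \<Rightarrow> 'a \<Rightarrow> 'a \<Rightarrow> 'a \<Rightarrow> 'a set \<Rightarrow> 'a set \<Rightarrow> bool" where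
  "rotatable G A B C D V1 V2 \<longleftrightarrow>
     (\<exists>X Y. two_colouring G X Y) \<and>
     distinct [A, B, C, D] \<and>
     verts G = {A, B, C, D} \<union> V1 \<union> V2 \<and>
     {A, B, C, D} \<inter> V1 = {} \<and> {A, B, C, D} \<inter> V2 = {} \<and> V1 \<inter> V2 = {} \<and>
     {e \<in> edges G. e \<subseteq> {A, B, C, D}} = {{A, B}, {B, C}, {C, D}, {D, A}} \<and>
     (\<forall>e\<in>edges G. e \<inter> V2 \<noteq> {} \<and> \<not> e \<subseteq> V2 \<longrightarrow> (\<exists>v\<in>V2. e = {D, v} \<or> e = {C, v})) \<and>
     (\<forall>e\<in>edges G. e \<inter> V1 \<noteq> {} \<and> \<not> e \<subseteq> V1 \<longrightarrow> (\<exists>v\<in>V1. e = {B, v} \<or> e = {C, v}))"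

text \<open>The tiles with a vertex in \<open>V2\<close> are carried along: their corners \<open>D\<close> and \<open>C\<close>, if present,
  become \<open>B\<close> and \<open>A\<close>.\<close>

definition rotate_tile :: "'a \<Rightarrow> 'a \<Rightarrow> 'a \<Rightarrow> 'a \<Rightarrow> 'a set \<Rightarrow> 'a tile \<Rightarrow> 'a tile" where
  "rotate_tile A B C D V2 t =
     (if set_tile t \<inter> V2 = {} then t
      else map_tile (\<lambda>v. if v = D then B else if v = C then A else v) t)"

definition rotate ::
  "'a tiled_graph \<Rightarrow> 'a \<Rightarrow> 'a \<Rightarrow> 'a \<Rightarrow> 'a \<Rightarrow> 'a set \<Rightarrow> 'a tiled_graph" where
  "rotate G A B C D V2 =
     (let S = {v \<in> V2. {D, v} \<in> edges G}; R = {v \<in> V2. {C, v} \<in> edges G}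
      in \<lparr>verts = verts G,
          edges = (edges G - ((\<lambda>v. {D, v}) ` S \<union> (\<lambda>v. {C, v}) ` R))
                   \<union> ((\<lambda>v. {B, v}) ` S \<union> (\<lambda>v. {A, v}) ` R),
          tiles = map (rotate_tile A B C D V2) (tiles G)\<rparr>)"

inductive generalised_snake_graph :: "(real \<times> real) tiled_graph \<Rightarrow> bool" where
  snake: "snake_graph G \<Longrightarrow> generalised_snake_graph G"
| rotation: "\<lbrakk>generalised_snake_graph G; t \<in> set (tiles G); set_tile t = {A, B, C, D};
    rotatable G A B C D V1 V2\<rbrakk> \<Longrightarrow> generalised_snake_graph (rotate G A B C D V2)"


section \<open>Turns\<close>

definition num_tiles_at :: "'a tiled_graph \<Rightarrow> 'a \<Rightarrow> nat" where
  "num_tiles_at G v = card {i. i < length (tiles G) \<and> v \<in> set_tile (tiles G ! i)}"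

definition turn :: "'a tiled_graph \<Rightarrow> 'a \<Rightarrow> bool" where
  "turn G v \<longleftrightarrow>
     num_tiles_at G v \<ge> 3 \<or>
     ((\<exists>t\<in>set (tiles G). \<exists>u. opposite_in t u v \<and> num_tiles_at G u \<ge> 3) \<and>
      num_tiles_at G v = 1 \<and>
      v \<notin> set_tile (hd (tiles G)) \<and> v \<notin> set_tile (last (tiles G)))"


section \<open>Faces and boundary paths\<close>

text \<open>Faces are given by their sets of bounding edges. Each edge separates two faces and the bounded
  faces are the tiles, so the edges on the unbounded face are those lying in exactly one tile.\<close>

definition outer_edges :: "'a tiled_graph \<Rightarrow> 'a set set" where
  "outer_edges G = {e \<in> edges G. \<exists>!i. i < length (tiles G) \<and> e \<in> tile_edges (tiles G ! i)}"

definition faces :: "'a tiled_graph \<Rightarrow> 'a set set set" where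
  "faces G = insert (outer_edges G) (tile_edges ` set (tiles G))"

text \<open>The vertices of tile \<open>k\<close> that belong to no other tile. For the first and for the last of at least
  two tiles there are two of them, and this set is the edge joining them.\<close>

definition private_vertices :: "'a tiled_graph \<Rightarrow> nat \<Rightarrow> 'a set" where
  "private_vertices G k =
     {v \<in> set_tile (tiles G ! k). \<forall>i < length (tiles G). i \<noteq> k \<longrightarrow> v \<notin> set_tile (tiles G ! i)}"

definition start_edge :: "'a tiled_graph \<Rightarrow> 'a set" where
  "start_edge G = private_vertices G 0"

definition end_edge :: "'a tiled_graph \<Rightarrow> 'a set" where
  "end_edge G = private_vertices G (length (tiles G) - 1)"

definition boundary_path_edges :: "'a tiled_graph \<Rightarrow> 'a set set" where
  "boundary_path_edges G = outer_edges G - {start_edge G, end_edge G}"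

text \<open>The vertex sets of the path through the lower left vertex of the first tile and of the
  other path.\<close>

definition sw_path :: "'a tiled_graph \<Rightarrow> 'a set" where
  "sw_path G = {v. (sw (hd (tiles G)), v) \<in> {(x, y). {x, y} \<in> boundary_path_edges G}\<^sup>*}"

definition other_path :: "'a tiled_graph \<Rightarrow> 'a set" where
  "other_path G = \<Union> (outer_edges G) - sw_path G"

definition next_tile_above :: "'a tiled_graph \<Rightarrow> bool" where
  "next_tile_above G \<longleftrightarrow> {nw (tiles G ! 0), ne (tiles G ! 0)} \<subseteq> set_tile (tiles G ! 1)"

definition upper_boundary :: "'a tiled_graph \<Rightarrow> 'a set" where
  "upper_boundary G = (if next_tile_above G then sw_path G else other_path G)"

definition lower_boundary :: "'a tiled_graph \<Rightarrow> 'a set" where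
  "lower_boundary G = (if next_tile_above G then other_path G else sw_path G)"


section \<open>Kasteleyn weightings, adjacency matrices and perfect matchings\<close>

definition kasteleyn :: "'a tiled_graph \<Rightarrow> ('a set \<Rightarrow> real) \<Rightarrow> bool" where
  "kasteleyn G w \<longleftrightarrow>
     (\<forall>e\<in>edges G. w e \<in> {1, -1}) \<and>
     (\<forall>F\<in>faces G.
        (card F mod 4 = 0 \<longrightarrow> odd (card {e \<in> F. w e = -1})) \<and>
        (card F mod 4 = 2 \<longrightarrow> even (card {e \<in> F. w e = -1})))"

text \<open>The lists \<open>bs\<close> and \<open>ws\<close> enumerate the black and the white vertices.\<close>

definition bipartite_adjacency ::
  "'a tiled_graph \<Rightarrow> ('a set \<Rightarrow> real) \<Rightarrow> 'a list \<Rightarrow> 'a list \<Rightarrow> real mat" where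
  "bipartite_adjacency G w bs ws =
     mat (length bs) (length ws)
       (\<lambda>(i, j). if {bs ! i, ws ! j} \<in> edges G then w {bs ! i, ws ! j} else 0)"

definition principal_submatrix :: "real mat \<Rightarrow> 'a list \<Rightarrow> 'a set \<Rightarrow> real mat" where
  "principal_submatrix M bs P =
     (let I = {i. i < length bs \<and> bs ! i \<in> P} in submatrix M I I)"

definition perfect_matching :: "'a tiled_graph \<Rightarrow> 'a set set \<Rightarrow> bool" where
  "perfect_matching G M \<longleftrightarrow> M \<subseteq> edges G \<and> (\<forall>v\<in>verts G. \<exists>!e. e \<in> M \<and> v \<in> e)"

end

theory Submission
  imports Defs
begin

text \<open>
  Every generalised snake graph is a chain of tiles in which the tiles before tile \<open>k\<close> and those from
  tile \<open>k\<close> on share exactly one edge: a rotation reglues the tiles on one side of a tile along another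
  of its edges. Building the graph up tile by tile, one keeps track of four determinants of the Gram matrix
  \<open>B B\<^sup>T\<close>: over the black vertices of either boundary path, over the first path without the black end
  \<open>b\<close> of the edge \<open>bc\<close> along which the next tile is glued, and over the second path without the only
  neighbour of the white end \<open>c\<close> there. With \<open>P\<close> the number of perfect matchings so far and \<open>Q\<close> the
  number of those of the graph without \<open>b\<close> and \<open>c\<close>, they are \<open>P\<close>, \<open>P\<close>, \<open>Q\<close> and \<open>P - Q\<close>.
  A new tile changes \<open>P\<close> into \<open>P + Q\<close> on the side of the matchings. On the side of the
  determinants it adds \<open>1\<close> to the diagonal entry at \<open>b\<close>, and it attaches a new black vertex to the other
  path, whose row has the diagonal entry \<open>2\<close> and a single other entry, \<open>\<plusminus>1\<close>. Since black vertices of one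
  path are linked by common white neighbours only along that path, their Gram matrix is tridiagonal and
  its determinant depends on the squares of the weights only.
\<close>


section \<open>Determinants indexed by finite sets\<close>

text \<open>Black turns keep the two black corners of every tile on opposite paths. A white vertex
  shared by both gluing edges of a tile would be a common neighbour of at least three black vertices
  on the path across from it, and the Gram matrix of that path would no longer be tridiagonal.
  Determinants are indexed by vertex sets, so that deleting \<open>b\<close> or attaching a new
  vertex is a set operation and no order of the rows has to be maintained. The other difficulty is
  that a rotation is given by vertex sets \<open>V1\<close> and \<open>V2\<close>, whereas the
  induction needs an order of the tiles. The link is connectedness: what lies strictly on one side
  of a tile stays connected when that tile is removed, so each side falls wholly into
  \<open>V1\<close> or wholly into \<open>V2\<close>. The prescribed edges between these sets and
  the square then force the gluing edge to be \<open>BC\<close> or \<open>CD\<close>, and since the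
  two gluing edges of a tile differ, \<open>V2\<close> cannot contain both sides. Coordinates matter
  only for the initial snake graph; after a rotation they are mere names of vertices.\<close>

definition det_on :: "'b set \<Rightarrow> ('b \<Rightarrow> 'b \<Rightarrow> real) \<Rightarrow> real" where
  "det_on S G = (\<Sum>p | p permutes S. of_int (sign p) * (\<Prod>i\<in>S. G i (p i)))"

lemma det_on_empty [simp]: "det_on {} G = 1"
  by (simp add: det_on_def)

lemma det_on_cong:
  assumes "\<And>x y. x \<in> S \<Longrightarrow> y \<in> S \<Longrightarrow> G x y = G' x y"
  shows "det_on S G = det_on S G'"
  unfolding det_on_def
  by (intro sum.cong refl arg_cong2[where f = "(*)"] prod.cong assms) (auto simp: permutes_in_image)

text \<open>Conjugation by \<open>f\<close> matches the permutations of \<open>A\<close> with those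
  of \<open>S\<close> and preserves signs, so renaming rows and columns simultaneously changes
  nothing.\<close>

lemma det_on_bij_betw:
  assumes "bij_betw f A S" "finite A"
  shows "det_on S G = det_on A (\<lambda>i j. G (f i) (f j))"
proof -
  have inj: "inj_on f A" and im: "f ` A = S"
    using assms(1) by (auto simp: bij_betw_def)
  define g where "g = inv_into A f"
  have g: "bij_betw g S A" "\<And>x. x \<in> S \<Longrightarrow> f (g x) = x" "\<And>x. x \<in> A \<Longrightarrow> g (f x) = x"
    using assms(1) by (auto simp: g_def bij_betw_inv_into bij_betw_inv_into_left bij_betw_inv_into_right)
  have "det_on A (\<lambda>i j. G (f i) (f j)) =
      (\<Sum>p | p permutes S. of_int (sign p) * (\<Prod>i\<in>S. G i (p i)))"
    unfolding det_on_def
  proof (rule sum.reindex_bij_witness[where j = "map_permutation A f" and i = "map_permutation S g"], goal_cases)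
    case (1 p)
    then show ?case using map_permutation_compose_inv[OF assms(1) _ g(3)] by auto
  next
    case (2 p)
    then show ?case using map_permutation_permutes[OF assms(1)] by auto
  next
    case (3 p)
    then show ?case using map_permutation_compose_inv[OF g(1) _ g(2)] by auto
  next
    case (4 p)
    then show ?case using map_permutation_permutes[OF g(1)] by auto
  next
    case (5 p)
    then have "(\<Prod>i\<in>S. G i (map_permutation A f p i)) = (\<Prod>i\<in>A. G (f i) (f (p i)))"
      unfolding im[symmetric]
      by (subst prod.reindex[OF inj]) (auto simp: map_permutation_apply[OF inj])
    then show ?case
      using 5 by (simp add: sign_map_permutation[OF inj _ assms(2)])
  qed
  then show ?thesis by (simp add: det_on_def)
qed

lemma permutes_fixing_point:
  "{p. p permutes S \<and> p b = b} = {p. p permutes (S - {b})}"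
proof (intro equalityI subsetI)
  fix p assume "p \<in> {p. p permutes S \<and> p b = b}"
  then show "p \<in> {p. p permutes (S - {b})}"
    using permutes_superset[of p S "S - {b}"] by auto
next
  fix p assume "p \<in> {p. p permutes (S - {b})}"
  then show "p \<in> {p. p permutes S \<and> p b = b}"
    using permutes_subset[of p "S - {b}" S] permutes_not_in[of p "S - {b}" b] by auto
qed

text \<open>The changed entry is seen only by permutations that fix \<open>b\<close>, and these are
  the permutations of the remaining indices.\<close>

lemma det_on_diagonal_update:
  assumes "finite S" "b \<in> S"
    and "\<And>x y. x \<in> S \<Longrightarrow> y \<in> S \<Longrightarrow> G' x y = G x y + (if x = b \<and> y = b then t else 0)"
  shows "det_on S G' = det_on S G + t * det_on (S - {b}) G"
proof -
  have prod: "(\<Prod>i\<in>S. G' i (p i)) =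
      (\<Prod>i\<in>S. G i (p i)) + (if p b = b then t * (\<Prod>i\<in>S - {b}. G i (p i)) else 0)"
    if "p permutes S" for p
  proof -
    have "(\<Prod>i\<in>S - {b}. G' i (p i)) = (\<Prod>i\<in>S - {b}. G i (p i))"
      using that assms(3) by (intro prod.cong) (auto simp: permutes_in_image)
    moreover have "p b \<in> S"
      using that assms(2) by (auto simp: permutes_in_image)
    ultimately show ?thesis
      using assms by (simp add: prod.remove[of S b] algebra_simps)
  qed
  have fin: "finite {p. p permutes S}"
    using assms(1) by (rule finite_permutations)
  have "det_on S G' = det_on S G +
      (\<Sum>p | p permutes S. if p b = b then t * (of_int (sign p) * (\<Prod>i\<in>S - {b}. G i (p i))) else 0)"
    unfolding det_on_def sum.distrib[symmetric]
    by (intro sum.cong refl) (auto simp: prod algebra_simps)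
  also have "(\<Sum>p | p permutes S. if p b = b then t * (of_int (sign p) * (\<Prod>i\<in>S - {b}. G i (p i))) else 0)
      = (\<Sum>p | p permutes S \<and> p b = b. t * (of_int (sign p) * (\<Prod>i\<in>S - {b}. G i (p i))))"
    by (subst sum.inter_filter[symmetric, OF fin]) simp
  also have "\<dots> = t * det_on (S - {b}) G"
    by (simp add: permutes_fixing_point det_on_def sum_distrib_left)
  finally show ?thesis .
qed

text \<open>Expansion along row and column of \<open>x\<close>. A permutation of the larger set is
  \<open>transpose x b\<close> after some \<open>q\<close> permuting \<open>S\<close>, and it sends
  \<open>x\<close> to \<open>b\<close>; the row vanishes unless \<open>b\<close> is \<open>x\<close>
  or \<open>n\<close>. The case distinction covers an \<open>x\<close> without any neighbour in
  \<open>S\<close>.\<close>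

lemma det_on_insert_leaf:
  assumes "finite S" "x \<notin> S"
    and "\<And>y. y \<in> S \<Longrightarrow> y \<noteq> n \<Longrightarrow> G x y = 0" "\<And>y. y \<in> S \<Longrightarrow> y \<noteq> n \<Longrightarrow> G y x = 0"
  shows "det_on (insert x S) G =
    G x x * det_on S G - (if n \<in> S then G x n * G n x * det_on (S - {n}) G else 0)"
proof -
  define f where "f p = real_of_int (sign p) * (\<Prod>i\<in>insert x S. G i (p i))" for p
  define F where "F b = (\<Sum>q | q permutes S. f (Transposition.transpose x b \<circ> q))" for b
  have fin: "finite {p. p permutes S}"
    using assms(1) by (rule finite_permutations)
  have sum: "det_on (insert x S) G = (\<Sum>b\<in>insert x S. F b)"
    unfolding det_on_def F_def f_def by (rule sum_over_permutations_insert[OF assms(1,2)])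
  have row: "f (Transposition.transpose x b \<circ> q) =
      of_int (sign (Transposition.transpose x b \<circ> q)) * G x b *
        (\<Prod>i\<in>S. G i (Transposition.transpose x b (q i)))" if "q permutes S" for q b
    using that assms(1,2) by (simp add: f_def permutes_not_in)
  have "F b = 0" if "b \<in> S" "b \<noteq> n" for b
    unfolding F_def using that assms(3) by (intro sum.neutral) (auto simp: row)
  then have "(\<Sum>b\<in>S. F b) = (\<Sum>b\<in>S. if b = n then F n else 0)"
    by (intro sum.cong) auto
  then have two: "det_on (insert x S) G = F x + (if n \<in> S then F n else 0)"
    unfolding sum using assms(1,2) by simp
  have "F x = G x x * det_on S G"
    unfolding F_def det_on_def sum_distrib_left
    using row[of _ x] by (intro sum.cong refl) simp
  moreover have "F n = - (G x n * G n x * det_on (S - {n}) G)" if n: "n \<in> S"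
  proof -
    have xn: "x \<noteq> n" using n assms(2) by auto
    \<comment> \<open>The composite sends the index \<open>i\<close> with \<open>q i = n\<close> to
      \<open>x\<close>, so the product contains \<open>G i x\<close>, which vanishes unless
      \<open>i = n\<close>. What survives are the permutations that swap \<open>x\<close> and
      \<open>n\<close>, whence the minus sign.\<close>
    have zero: "f (Transposition.transpose x n \<circ> q) =
        (if q n = n then - (G x n * G n x) * (of_int (sign q) * (\<Prod>i\<in>S - {n}. G i (q i))) else 0)"
      if q: "q permutes S" for q
    proof (cases "q n = n")
      case True
      have "(\<Prod>i\<in>S - {n}. G i (Transposition.transpose x n (q i))) = (\<Prod>i\<in>S - {n}. G i (q i))"
      proof (rule prod.cong)
        fix i assume i: "i \<in> S - {n}"
        then have "q i \<in> S" using q by (auto simp: permutes_in_image)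
        moreover have "q i \<noteq> n" using i True by (metis DiffD2 insertI1 injD[OF permutes_inj[OF q]])
        ultimately show "G i (Transposition.transpose x n (q i)) = G i (q i)"
          using assms(2) by (subst transpose_apply_other) auto
      qed simp
      moreover have "sign (Transposition.transpose x n \<circ> q) = - sign q"
        using permutes_imp_permutation[OF assms(1) q] xn
        by (simp add: sign_compose permutation_swap_id sign_swap_id)
      ultimately show ?thesis
        using True n assms(1) by (simp add: row[OF q] prod.remove[of S n])
    next
      case False
      obtain i where i: "i \<in> S" "q i = n"
        using permutes_image[OF q] n by (metis imageE)
      then have "i \<noteq> n" using False by auto
      then have "G i (Transposition.transpose x n (q i)) = 0"
        using i assms(4) by simp
      then have "(\<Prod>i\<in>S. G i (Transposition.transpose x n (q i))) = 0"
        using i(1) assms(1) by (intro prod_zero) auto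
      then show ?thesis
        using False by (simp add: row[OF q])
    qed
    have "F n = (\<Sum>q | q permutes S. if q n = n
        then - (G x n * G n x) * (of_int (sign q) * (\<Prod>i\<in>S - {n}. G i (q i))) else 0)"
      unfolding F_def by (intro sum.cong refl) (simp add: zero)
    also have "\<dots> = (\<Sum>q | q permutes S \<and> q n = n.
        - (G x n * G n x) * (of_int (sign q) * (\<Prod>i\<in>S - {n}. G i (q i))))"
      by (subst sum.inter_filter[symmetric, OF fin]) simp
    also have "\<dots> = - (G x n * G n x * det_on (S - {n}) G)"
      unfolding permutes_fixing_point det_on_def sum_distrib_left[symmetric] by simp
    finally show ?thesis .
  qed
  ultimately show ?thesis
    unfolding two by simp
qed

section \<open>Principal submatrices as determinants over vertex sets\<close>

lemma bij_betw_pick: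
  assumes "finite I"
  shows "bij_betw (pick I) {0..<card I} I"
proof (rule bij_betw_imageI)
  show "inj_on (pick I) {0..<card I}"
  proof (rule inj_onI)
    fix i j assume "i \<in> {0..<card I}" "j \<in> {0..<card I}" "pick I i = pick I j"
    then show "i = j"
      using pick_mono_le[of i I j] pick_mono_le[of j I i] by (cases i j rule: linorder_cases) auto
  qed
  show "pick I ` {0..<card I} = I"
  proof
    show "pick I ` {0..<card I} \<subseteq> I"
      using pick_in_set_le by auto
    show "I \<subseteq> pick I ` {0..<card I}"
    proof
      fix i assume i: "i \<in> I"
      have "card {a \<in> I. a < i} < card I"
        using i assms by (intro psubset_card_mono) auto
      then show "i \<in> pick I ` {0..<card I}"
        using pick_card_in_set[OF i] by (intro image_eqI[where x = "card {a \<in> I. a < i}"]) auto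
    qed
  qed
qed

text \<open>\<open>pick\<close> numbers the selected positions increasingly, so the submatrix is a
  relabelling of the vertices in \<open>P\<close>. In particular its determinant does not depend on
  the order in which \<open>bs\<close> lists the vertices.\<close>

lemma det_principal_submatrix:
  assumes "distinct bs" "\<And>i j. i < length bs \<Longrightarrow> j < length bs \<Longrightarrow> M $$ (i, j) = G (bs ! i) (bs ! j)"
    and "dim_row M = length bs" "dim_col M = length bs"
  shows "det (principal_submatrix M bs P) = det_on (P \<inter> set bs) G"
proof -
  define I where "I = {i. i < length bs \<and> bs ! i \<in> P}"
  have I: "finite I" "{i. i < length bs \<and> i \<in> I} = I"
    by (auto simp: I_def)
  have pI: "pick I i \<in> I" if "i < card I" for i
    using pick_in_set_le[OF that] .
  have bij: "bij_betw (\<lambda>i. bs ! pick I i) {0..<card I} (P \<inter> set bs)"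
  proof -
    have "bij_betw ((!) bs) I (P \<inter> set bs)"
      by (rule bij_betw_subset[OF bij_betw_nth[OF assms(1) refl refl]])
        (auto simp: I_def in_set_conv_nth)
    then show ?thesis
      using bij_betw_trans[OF bij_betw_pick[OF I(1)]] by (simp add: comp_def)
  qed
  have sub: "submatrix M I I = mat (card I) (card I) (\<lambda>(i, j). M $$ (pick I i, pick I j))"
    unfolding submatrix_def assms(3,4) I(2) ..
  have "det (principal_submatrix M bs P) = (\<Sum>p | p permutes {0..<card I}. of_int (sign p) *
      (\<Prod>i = 0..<card I. mat (card I) (card I) (\<lambda>(i, j). M $$ (pick I i, pick I j)) $$ (i, p i)))"
    unfolding principal_submatrix_def Let_def I_def[symmetric] sub det_def by simp
  also have "\<dots> = det_on {0..<card I} (\<lambda>i j. G (bs ! pick I i) (bs ! pick I j))"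
    unfolding det_on_def
  proof (intro sum.cong refl arg_cong2[where f = "(*)"] prod.cong)
    fix p i assume p: "p \<in> {p. p permutes {0..<card I}}" and i: "i \<in> {0..<card I}"
    then have "p i < card I"
      using permutes_in_image[of p "{0..<card I}" i] by simp
    then have "pick I i < length bs" "pick I (p i) < length bs"
      using pI[of i] pI[of "p i"] i by (simp_all add: I_def)
    then show "mat (card I) (card I) (\<lambda>(i, j). M $$ (pick I i, pick I j)) $$ (i, p i) =
        G (bs ! pick I i) (bs ! pick I (p i))"
      using i \<open>p i < card I\<close> by (simp add: assms(2))
  qed
  also have "\<dots> = det_on (P \<inter> set bs) G"
    using det_on_bij_betw[OF bij, of G] by simp
  finally show ?thesis .
qed


section \<open>Perfect matchings of induced subgraphs\<close>

text \<open>The vertex set is a separate argument so that vertices can be deleted while the edge set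
  stays the same.\<close>

definition matchings :: "'a set set \<Rightarrow> 'a set \<Rightarrow> 'a set set set" where
  "matchings E W = {M. M \<subseteq> {e \<in> E. e \<subseteq> W} \<and> (\<forall>v\<in>W. \<exists>!e. e \<in> M \<and> v \<in> e)}"

lemma matchings_cong:
  "{e \<in> E. e \<subseteq> W} = {e \<in> E'. e \<subseteq> W} \<Longrightarrow> matchings E W = matchings E' W"
  by (simp add: matchings_def)

lemma finite_matchings: "finite E \<Longrightarrow> finite (matchings E W)"
  by (rule finite_subset[of _ "Pow E"]) (auto simp: matchings_def)

lemma matchings_remove_edge:
  assumes "M \<in> matchings E W" "e \<in> M"
  shows "M - {e} \<in> matchings E (W - e)"
  unfolding matchings_def
proof (intro CollectI conjI ballI)
  have M: "M \<subseteq> {e \<in> E. e \<subseteq> W}" and ex1: "\<And>v. v \<in> W \<Longrightarrow> \<exists>!f. f \<in> M \<and> v \<in> f"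
    using assms(1) by (simp_all add: matchings_def)
  show "M - {e} \<subseteq> {f \<in> E. f \<subseteq> W - e}"
  proof
    fix f assume f: "f \<in> M - {e}"
    have "u \<notin> e" if "u \<in> f" for u
    proof
      assume "u \<in> e"
      moreover have "u \<in> W" using that f M by auto
      ultimately show False
        using ex1[of u] f that assms(2) by (metis DiffE singletonI)
    qed
    then show "f \<in> {f \<in> E. f \<subseteq> W - e}"
      using f M by auto
  qed
  fix v assume v: "v \<in> W - e"
  then have "(f \<in> M - {e} \<and> v \<in> f) = (f \<in> M \<and> v \<in> f)" for f
    by auto
  then show "\<exists>!f. f \<in> M - {e} \<and> v \<in> f"
    using ex1[of v] v by simp
qed

lemma matchings_insert_edge:
  assumes "M \<in> matchings E (W - e)" "e \<in> E" "e \<subseteq> W"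
  shows "insert e M \<in> matchings E W"
  unfolding matchings_def
proof (intro CollectI conjI ballI)
  have M: "M \<subseteq> {f \<in> E. f \<subseteq> W - e}"
    using assms(1) by (simp add: matchings_def)
  show "insert e M \<subseteq> {f \<in> E. f \<subseteq> W}"
    using M assms(2,3) by auto
  fix v assume v: "v \<in> W"
  show "\<exists>!f. f \<in> insert e M \<and> v \<in> f"
  proof (cases "v \<in> e")
    case True
    then have "(f \<in> insert e M \<and> v \<in> f) = (f = e)" for f
      using M by auto
    then show ?thesis by simp
  next
    case False
    then have "(f \<in> insert e M \<and> v \<in> f) = (f \<in> M \<and> v \<in> f)" for f
      by auto
    moreover have "\<exists>!f. f \<in> M \<and> v \<in> f"
      using assms(1) v False by (simp add: matchings_def)
    ultimately show ?thesis by simp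
  qed
qed

text \<open>Matchings are sorted by the edge that covers \<open>v\<close>; removing this edge is a
  bijection onto the matchings of what is left.\<close>

lemma card_matchings_expand:
  assumes "finite E" "v \<in> W"
  shows "card (matchings E W) = (\<Sum>e | e \<in> E \<and> e \<subseteq> W \<and> v \<in> e. card (matchings E (W - e)))"
proof -
  define D where "D = {e. e \<in> E \<and> e \<subseteq> W \<and> v \<in> e}"
  have fin: "finite D"
    using assms(1) by (auto simp: D_def)
  have notin: "f \<notin> M" if "M \<in> matchings E (W - e)" "v \<in> e" "v \<in> f" for M e f
    using that unfolding matchings_def by blast
  have "matchings E W = (\<Union>e\<in>D. insert e ` matchings E (W - e))"
  proof (intro equalityI subsetI)
    fix M assume M: "M \<in> matchings E W"
    then have "\<exists>!e. e \<in> M \<and> v \<in> e"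
      using assms(2) by (simp add: matchings_def)
    from ex1_implies_ex[OF this] obtain e where e: "e \<in> M" "v \<in> e"
      by blast
    then have "e \<in> D"
      using M by (simp add: D_def matchings_def subset_iff)
    moreover have "M \<in> insert e ` matchings E (W - e)"
      using matchings_remove_edge[OF M e(1)] e(1) by (intro image_eqI[of _ _ "M - {e}"]) auto
    ultimately show "M \<in> (\<Union>e\<in>D. insert e ` matchings E (W - e))"
      by blast
  next
    fix M assume "M \<in> (\<Union>e\<in>D. insert e ` matchings E (W - e))"
    then show "M \<in> matchings E W"
      by (auto simp: D_def intro: matchings_insert_edge)
  qed
  also have "card \<dots> = (\<Sum>e\<in>D. card (insert e ` matchings E (W - e)))"
  proof (intro card_UN_disjoint fin ballI impI)
    show "finite (insert e ` matchings E (W - e))" for e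
      using finite_matchings[OF assms(1)] by simp
  next
    fix e f assume ef: "e \<in> D" "f \<in> D" "e \<noteq> f"
    then have v: "v \<in> e" "v \<in> f" by (auto simp: D_def)
    show "insert e ` matchings E (W - e) \<inter> insert f ` matchings E (W - f) = {}"
    proof (rule ccontr)
      assume "\<not> ?thesis"
      then obtain M N where "M \<in> matchings E (W - e)" "insert e M = insert f N"
        by blast
      then show False
        using notin[of M e f] v ef(3) by blast
    qed
  qed
  also have "\<dots> = (\<Sum>e\<in>D. card (matchings E (W - e)))"
  proof (intro sum.cong refl card_image inj_onI)
    fix e M N assume e: "e \<in> D" and M: "M \<in> matchings E (W - e)" and N: "N \<in> matchings E (W - e)"
      and eq: "insert e M = insert e N"
    have "v \<in> e" using e by (simp add: D_def)
    then have "e \<notin> M" "e \<notin> N"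
      using notin M N by blast+
    then show "M = N" using eq insert_ident by metis
  qed
  finally show ?thesis by (simp add: D_def)
qed

lemma matchings_no_vertices: "{} \<notin> E \<Longrightarrow> matchings E {} = {{}}"
  by (auto simp: matchings_def)

text \<open>The vertex \<open>c'\<close> can be matched only with \<open>b'\<close> or
  \<open>b\<close>. The first choice leaves the old graph; after the second, \<open>b'\<close> is
  forced to take \<open>c\<close>, which leaves the old graph without \<open>b\<close> and
  \<open>c\<close>. The other two counts belong to the two possible next gluing edges,
  \<open>bc'\<close> and \<open>b'c'\<close>.\<close>

lemma card_matchings_glue_tile:
  assumes fin: "finite E" and V: "\<Union>E \<subseteq> V" and b: "b \<in> V" and c: "c \<in> V" and bc: "b \<noteq> c"
    and b': "b' \<notin> V" and c': "c' \<notin> V" and bc': "b' \<noteq> c'"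
    and E': "E' = E \<union> {{b, c'}, {b', c'}, {b', c}}"
    and V': "V' = insert b' (insert c' V)"
  shows "card (matchings E' V') = card (matchings E V) + card (matchings E (V - {b, c}))"
    and "card (matchings E' (V' - {b, c'})) = card (matchings E (V - {b, c}))"
    and "card (matchings E' (V' - {b', c'})) = card (matchings E V)"
proof -
  have fin': "finite E'" using fin E' by simp
  have nE: "b' \<notin> e" "c' \<notin> e" if "e \<in> E" for e
    using that V b' c' by auto
  have ne: "b \<noteq> b'" "b \<noteq> c'" "c \<noteq> b'" "c \<noteq> c'"
    using b c b' c' by auto
  have old: "matchings E' W = matchings E W" if "W \<subseteq> V" for W
    using that b' c' by (intro matchings_cong) (auto simp: E')
  have "{e. e \<in> E' \<and> e \<subseteq> V' - {b, c'} \<and> b' \<in> e} = {{b', c}}"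
    using ne bc bc' c nE by (auto simp: E' V')
  moreover have "V' - {b, c'} - {b', c} = V - {b, c}"
    using b' c' ne by (auto simp: V')
  moreover have "b' \<in> V' - {b, c'}"
    using ne bc' by (auto simp: V')
  ultimately show q: "card (matchings E' (V' - {b, c'})) = card (matchings E (V - {b, c}))"
    using card_matchings_expand[OF fin', of b' "V' - {b, c'}"] old[of "V - {b, c}"] by auto
  have "V' - {b', c'} = V"
    using b' c' by (auto simp: V')
  then show p: "card (matchings E' (V' - {b', c'})) = card (matchings E V)"
    using old[of V] by simp
  have "{e. e \<in> E' \<and> e \<subseteq> V' \<and> c' \<in> e} = {{b, c'}, {b', c'}}"
    using ne bc' b nE by (auto simp: E' V')
  moreover have "{b, c'} \<noteq> {b', c'}" "c' \<in> V'"
    using ne bc' by (auto simp: doubleton_eq_iff V')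
  ultimately have "card (matchings E' V') =
      card (matchings E' (V' - {b, c'})) + card (matchings E' (V' - {b', c'}))"
    using card_matchings_expand[OF fin', of c' V'] by simp
  then show "card (matchings E' V') = card (matchings E V) + card (matchings E (V - {b, c}))"
    by (simp only: p q)
qed


section \<open>Gluing a tile to the Gram matrix\<close>

definition adj :: "'a set set \<Rightarrow> ('a set \<Rightarrow> real) \<Rightarrow> 'a \<Rightarrow> 'a \<Rightarrow> real" where
  "adj E w x z = (if {x, z} \<in> E then w {x, z} else 0)"

text \<open>These are the entries of \<open>B\<close> times its transpose. The white set stays fixed
  while \<open>E\<close> grows; white vertices not yet attached contribute zero.\<close>

definition gram :: "'a set set \<Rightarrow> ('a set \<Rightarrow> real) \<Rightarrow> 'a set \<Rightarrow> 'a \<Rightarrow> 'a \<Rightarrow> real" where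
  "gram E w Wh x y = (\<Sum>z\<in>Wh. adj E w x z * adj E w y z)"

lemma gram_commute: "gram E w Wh x y = gram E w Wh y x"
  by (simp add: gram_def mult.commute)

text \<open>Among old black vertices only \<open>b\<close> sees the new white vertex
  \<open>c'\<close>, which adds the square of one weight to one diagonal entry. The new black vertex
  \<open>b'\<close> sees just \<open>c\<close> and \<open>c'\<close>, so its row is the column of
  \<open>c\<close> up to sign. The vertex \<open>b\<close> is excluded there because it also shares
  \<open>c'\<close> with \<open>b'\<close>.\<close>

lemma gram_glue_tile:
  assumes V: "\<Union>E \<subseteq> V" and b: "b \<in> V" "b \<in> Bk" and c: "c \<in> V" "c \<in> Wh"
    and b': "b' \<notin> V" "b' \<in> Bk" and c': "c' \<notin> V" "c' \<in> Wh"
    and E': "E' = E \<union> {{b, c'}, {b', c'}, {b', c}}"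
    and w: "\<And>e. e \<in> E' \<Longrightarrow> w e * w e = 1"
    and Wh: "finite Wh" "Wh \<inter> Bk = {}"
  shows "x \<in> V \<inter> Bk \<Longrightarrow> y \<in> V \<inter> Bk \<Longrightarrow>
      gram E' w Wh x y = gram E w Wh x y + (if x = b \<and> y = b then 1 else 0)"
    and "x \<in> V \<inter> Bk \<Longrightarrow> x \<noteq> b \<Longrightarrow> gram E' w Wh b' x = w {b', c} * adj E w x c"
    and "gram E' w Wh b' b' = 2"
proof -
  have nE: "{x, c'} \<notin> E" "{x, b'} \<notin> E" "{c', x} \<notin> E" "{b', x} \<notin> E" for x
    using V b' c' by auto
  have ne: "b \<noteq> b'" "b \<noteq> c'" "c \<noteq> b'" "c \<noteq> c'" "b \<noteq> c" "b' \<noteq> c'"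
    using b c b' c' Wh(2) by auto
  have w2: "w {b, c'} * w {b, c'} = 1" "w {b', c'} * w {b', c'} = 1" "w {b', c} * w {b', c} = 1"
    by (auto intro!: w simp: E')
  have edge: "{x, z} \<in> E' \<longleftrightarrow> {x, z} \<in> E \<or> x = b \<and> z = c'" if "x \<in> V \<inter> Bk" for x z
    using that b' c' c Wh(2) by (auto simp: E' doubleton_eq_iff)
  have old: "adj E' w x z = (if z = c' then if x = b then w {b, c'} else 0 else adj E w x z)"
    if "x \<in> V \<inter> Bk" for x z
    using edge[OF that, of z] nE by (auto simp: adj_def)
  have new: "adj E' w b' z = (if z = c then w {b', c} else if z = c' then w {b', c'} else 0)"
    if "z \<in> Wh" for z
    using that ne b' Wh(2) nE by (auto simp: adj_def E' doubleton_eq_iff)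
  have zero: "adj E w x c' = 0" for x
    using nE by (simp add: adj_def)
  show "gram E' w Wh x y = gram E w Wh x y + (if x = b \<and> y = b then 1 else 0)"
    if xy: "x \<in> V \<inter> Bk" "y \<in> V \<inter> Bk" for x y
  proof -
    have "gram E' w Wh x y = (\<Sum>z\<in>Wh. adj E w x z * adj E w y z +
        (if z = c' then if x = b \<and> y = b then 1 else 0 else 0))"
      unfolding gram_def by (intro sum.cong refl) (simp add: old[OF xy(1)] old[OF xy(2)] zero w2)
    then show ?thesis
      using Wh(1) c'(2) by (simp add: sum.distrib gram_def)
  qed
  show "gram E' w Wh b' x = w {b', c} * adj E w x c" if x: "x \<in> V \<inter> Bk" "x \<noteq> b" for x
  proof -
    have "gram E' w Wh b' x = (\<Sum>z\<in>Wh. if z = c then w {b', c} * adj E w x c else 0)"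
      unfolding gram_def using x(2) ne by (intro sum.cong refl) (auto simp: old[OF x(1)] new zero)
    then show ?thesis
      using Wh(1) c(2) by simp
  qed
  have "gram E' w Wh b' b' = (\<Sum>z\<in>Wh. (if z = c then 1 else 0) + (if z = c' then 1 else 0))"
    unfolding gram_def using ne by (intro sum.cong refl) (auto simp: new w2)
  then show "gram E' w Wh b' b' = 2"
    using Wh(1) c(2) c'(2) by (simp add: sum.distrib)
qed


section \<open>Strips of tiles\<close>

text \<open>\<open>U\<close> and \<open>L\<close> are the vertex sets of the two boundary paths and \<open>F\<close> their edges. The edge joining the
  black vertex \<open>b\<close> in \<open>U\<close> to the white vertex \<open>c\<close> in \<open>L\<close> is the one along which the next tile is
  glued, and \<open>n\<close> is the only possible neighbour of \<open>c\<close> in \<open>L\<close>. If the edges along which a tile is glued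
  to its neighbours are disjoint (\<open>straight\<close>), the tile adds a white vertex to the path of \<open>b\<close> and a
  black one to that of \<open>c\<close>, so the two paths change roles. If they share a vertex (\<open>pivot\<close>), that
  vertex is black.\<close>

inductive strip ::
  "'a set \<Rightarrow> 'a set \<Rightarrow> 'a set \<Rightarrow> 'a \<Rightarrow> 'a \<Rightarrow> 'a \<Rightarrow> 'a set set \<Rightarrow> 'a set set \<Rightarrow> bool" for Bk where
  edge: "\<lbrakk>b \<in> Bk; c \<notin> Bk\<rbrakk> \<Longrightarrow> strip Bk {b} {c} b c b {{b, c}} {}"
| straight: "\<lbrakk>strip Bk U L b c n E F; b' \<in> Bk; c' \<notin> Bk; b' \<notin> U \<union> L; c' \<notin> U \<union> L\<rbrakk> \<Longrightarrow>
    strip Bk (insert b' L) (insert c' U) b' c' b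
      (E \<union> {{b, c'}, {b', c'}, {b', c}}) (F \<union> {{b, c'}, {b', c}})"
| pivot: "\<lbrakk>strip Bk U L b c n E F; b' \<in> Bk; c' \<notin> Bk; b' \<notin> U \<union> L; c' \<notin> U \<union> L\<rbrakk> \<Longrightarrow>
    strip Bk U (insert b' (insert c' L)) b c' b'
      (E \<union> {{b, c'}, {b', c'}, {b', c}}) (F \<union> {{b', c'}, {b', c}})"

lemma strip_finite: "strip Bk U L b c n E F \<Longrightarrow> finite U \<and> finite L \<and> finite E"
  by (induction rule: strip.induct) auto

lemma strip_disjoint: "strip Bk U L b c n E F \<Longrightarrow> U \<inter> L = {}"
  by (induction rule: strip.induct) auto

lemma strip_ends:
  "strip Bk U L b c n E F \<Longrightarrow> b \<in> U \<and> b \<in> Bk \<and> c \<in> L \<and> c \<notin> Bk \<and> {b, c} \<in> E"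
  by (induction rule: strip.induct) auto

lemma strip_Union: "strip Bk U L b c n E F \<Longrightarrow> \<Union>E = U \<union> L"
proof (induction rule: strip.induct)
  case (straight U L b c n E F b' c')
  then show ?case using strip_ends[OF straight.hyps(1)] by auto
next
  case (pivot U L b c n E F b' c')
  then show ?case using strip_ends[OF pivot.hyps(1)] by auto
qed auto

text \<open>The statement is conditional because \<open>c\<close> has no neighbour in
  \<open>L\<close> when the strip is a single edge; there \<open>n\<close> is set to
  \<open>b\<close>, which lies on the other path.\<close>

lemma strip_neighbour:
  "strip Bk U L b c n E F \<Longrightarrow> n \<in> Bk \<and> (n \<in> L \<longrightarrow> {n, c} \<in> E) \<and> (\<forall>x\<in>L. {x, c} \<in> E \<longrightarrow> x = n)"
proof (induction rule: strip.induct)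
  case (straight U L b c n E F b' c')
  have "{x, c'} \<notin> E" for x
    using strip_Union[OF straight.hyps(1)] straight.hyps by auto
  then show ?case
    using straight.hyps strip_ends[OF straight.hyps(1)] by (auto simp: doubleton_eq_iff)
next
  case (pivot U L b c n E F b' c')
  have "{x, c'} \<notin> E" for x
    using strip_Union[OF pivot.hyps(1)] pivot.hyps by auto
  then show ?case
    using pivot.hyps strip_ends[OF pivot.hyps(1)] strip_disjoint[OF pivot.hyps(1)]
    by (auto simp: doubleton_eq_iff)
qed auto

text \<open>The path of \<open>b\<close> changes only by the diagonal entry at \<open>b\<close>.
  Since \<open>b\<close> is not in \<open>L\<close>, the matrix on \<open>L\<close> is unchanged,
  and \<open>b'\<close> hangs on it as a leaf: it meets \<open>L\<close> only through
  \<open>c\<close>, whose one possible neighbour there is \<open>n\<close>.\<close>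

lemma strip_glue_tile_det:
  assumes s: "strip Bk U L b c n E F" and new: "b' \<in> Bk" "c' \<notin> Bk" "b' \<notin> U \<union> L" "c' \<notin> U \<union> L"
    and E': "E' = E \<union> {{b, c'}, {b', c'}, {b', c}}"
    and w: "\<And>e. e \<in> E' \<Longrightarrow> w e * w e = 1"
    and Wh: "finite Wh" "Wh \<inter> Bk = {}" "insert c' (U \<union> L) - Bk \<subseteq> Wh"
  shows "det_on (U \<inter> Bk) (gram E' w Wh) =
      det_on (U \<inter> Bk) (gram E w Wh) + det_on (U \<inter> Bk - {b}) (gram E w Wh)"
    and "det_on (U \<inter> Bk - {b}) (gram E' w Wh) = det_on (U \<inter> Bk - {b}) (gram E w Wh)"
    and "det_on (L \<inter> Bk) (gram E' w Wh) = det_on (L \<inter> Bk) (gram E w Wh)"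
    and "det_on (insert b' (L \<inter> Bk)) (gram E' w Wh) = 2 * det_on (L \<inter> Bk) (gram E w Wh) -
      (if n \<in> L then det_on (L \<inter> Bk - {n}) (gram E w Wh) else 0)"
proof -
  let ?G = "gram E w Wh" and ?G' = "gram E' w Wh"
  note fin = strip_finite[OF s] and ends = strip_ends[OF s]
  note n = strip_neighbour[OF s, THEN conjunct1]
    strip_neighbour[OF s, THEN conjunct2, THEN conjunct1, THEN mp]
  have disj: "b \<notin> L" using strip_disjoint[OF s] ends by auto
  have cWh: "c \<in> Wh" "c' \<in> Wh" using ends Wh(3) new(2) by auto
  have V: "\<Union>E \<subseteq> U \<union> L" using strip_Union[OF s] by simp
  have VV: "b \<in> U \<union> L" "b \<in> Bk" "c \<in> U \<union> L" using ends by auto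
  note glue = gram_glue_tile[where E' = E' and w = w,
      OF V VV(1,2,3) cWh(1) new(3,1,4) cWh(2) E' w Wh(1,2)]
  have old: "?G' x y = ?G x y + (if x = b \<and> y = b then 1 else 0)"
    if "x \<in> (U \<union> L) \<inter> Bk" "y \<in> (U \<union> L) \<inter> Bk" for x y
    using glue(1)[where x = x and y = y] that by simp
  show "det_on (U \<inter> Bk) ?G' = det_on (U \<inter> Bk) ?G + det_on (U \<inter> Bk - {b}) ?G"
    using det_on_diagonal_update[of "U \<inter> Bk" b ?G' ?G 1] old fin ends by auto
  show "det_on (U \<inter> Bk - {b}) ?G' = det_on (U \<inter> Bk - {b}) ?G"
    by (rule det_on_cong) (auto simp: old)
  have L: "det_on S ?G' = det_on S ?G" if "S \<subseteq> L \<inter> Bk" for S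
    by (rule det_on_cong) (use that disj in \<open>auto simp: old subset_iff\<close>)
  then show "det_on (L \<inter> Bk) ?G' = det_on (L \<inter> Bk) ?G" by simp
  have row: "?G' b' x = w {b', c} * adj E w x c" if "x \<in> L \<inter> Bk" for x
    using glue(2)[where x = x] that disj by auto
  have zero: "?G' b' x = 0" if "x \<in> L \<inter> Bk" "x \<noteq> n" for x
  proof -
    have "{x, c} \<notin> E" using strip_neighbour[OF s] that by blast
    then show ?thesis using row[OF that(1)] by (simp add: adj_def)
  qed
  \<comment> \<open>The entry is a product of the weights of \<open>b'c\<close> and
    \<open>nc\<close>, and the two symmetric entries multiply to the squares of these
    weights.\<close>
  have one: "?G' b' n * ?G' n b' = 1" if "n \<in> L"
  proof -
    have "{n, c} \<in> E" "n \<in> Bk" using n that by auto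
    then have "?G' b' n = w {b', c} * w {n, c}"
      using row[of n] that by (simp add: adj_def)
    moreover have "w {b', c} * w {b', c} = 1" "w {n, c} * w {n, c} = 1"
      using \<open>{n, c} \<in> E\<close> by (auto intro: w simp only: E')
    ultimately show ?thesis
      by (simp add: gram_commute[of E' w Wh n] algebra_simps)
  qed
  have "det_on (insert b' (L \<inter> Bk)) ?G' = ?G' b' b' * det_on (L \<inter> Bk) ?G' -
      (if n \<in> L \<inter> Bk then ?G' b' n * ?G' n b' * det_on (L \<inter> Bk - {n}) ?G' else 0)"
  proof (rule det_on_insert_leaf)
    show "finite (L \<inter> Bk)" "b' \<notin> L \<inter> Bk" using fin new(3) by auto
    show "?G' b' y = 0" "?G' y b' = 0" if "y \<in> L \<inter> Bk" "y \<noteq> n" for y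
      using zero[OF that] gram_commute[of E' w Wh y b'] by auto
  qed
  then show "det_on (insert b' (L \<inter> Bk)) ?G' = 2 * det_on (L \<inter> Bk) ?G -
      (if n \<in> L then det_on (L \<inter> Bk - {n}) ?G else 0)"
    using n(1) one glue(3) L[of "L \<inter> Bk"] L[of "L \<inter> Bk - {n}"] by auto
qed

lemma strip_glue_tile_matchings:
  assumes s: "strip Bk U L b c n E F" and new: "b' \<in> Bk" "c' \<notin> Bk" "b' \<notin> U \<union> L" "c' \<notin> U \<union> L"
    and E': "E' = E \<union> {{b, c'}, {b', c'}, {b', c}}" and V': "V' = insert b' (insert c' (U \<union> L))"
  shows "card (matchings E' V') = card (matchings E (U \<union> L)) + card (matchings E (U \<union> L - {b, c}))"
    and "card (matchings E' (V' - {b, c'})) = card (matchings E (U \<union> L - {b, c}))"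
    and "card (matchings E' (V' - {b', c'})) = card (matchings E (U \<union> L))"
proof -
  have "finite E" "\<Union>E \<subseteq> U \<union> L" "b \<in> U \<union> L" "c \<in> U \<union> L" "b \<noteq> c" "b' \<noteq> c'"
    using strip_finite[OF s] strip_ends[OF s] strip_Union[OF s] new by auto
  note glue = card_matchings_glue_tile[OF this(1-5) new(3,4) this(6) E' V']
  show "card (matchings E' V') = card (matchings E (U \<union> L)) + card (matchings E (U \<union> L - {b, c}))"
    and "card (matchings E' (V' - {b, c'})) = card (matchings E (U \<union> L - {b, c}))"
    and "card (matchings E' (V' - {b', c'})) = card (matchings E (U \<union> L))"
    by (rule glue)+
qed

text \<open>A straight tile turns the pair \<open>(P, Q)\<close> into \<open>(P + Q, P)\<close>, a
  pivot into \<open>(P + Q, Q)\<close>. The last conjunct is what closes the recursion: it rewrites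
  the leaf expansion \<open>2 * P - (P - Q)\<close> as \<open>P + Q\<close>. For a single edge
  \<open>P = Q = 1\<close>, which agrees with subtracting \<open>0\<close> when \<open>n\<close> is
  not in \<open>L\<close>.\<close>

lemma strip_det_eq_card_matchings:
  assumes "strip Bk U L b c n E F" "\<And>e. e \<in> E \<Longrightarrow> w e * w e = 1"
    and "finite Wh" "Wh \<inter> Bk = {}" "(U \<union> L) - Bk \<subseteq> Wh"
  shows "det_on (U \<inter> Bk) (gram E w Wh) = card (matchings E (U \<union> L)) \<and>
    det_on (U \<inter> Bk - {b}) (gram E w Wh) = card (matchings E (U \<union> L - {b, c})) \<and>
    det_on (L \<inter> Bk) (gram E w Wh) = card (matchings E (U \<union> L)) \<and>
    det_on (L \<inter> Bk) (gram E w Wh) - (if n \<in> L then det_on (L \<inter> Bk - {n}) (gram E w Wh) else 0) =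
      card (matchings E (U \<union> L - {b, c}))"
  using assms(1,2,5)
proof (induction rule: strip.induct)
  case (edge b c)
  have bc: "b \<noteq> c" using edge by auto
  have UV: "{b} \<union> {c} = {b, c}" by auto
  have "{e \<in> {{b, c}}. e \<subseteq> {b, c} \<and> b \<in> e} = {{b, c}}" by auto
  then have "card (matchings {{b, c}} {b, c}) = 1"
    using card_matchings_expand[of "{{b, c}}" b "{b, c}"]
    by (simp add: matchings_no_vertices)
  moreover have "det_on {b} (gram {{b, c}} w Wh) = 1"
  proof -
    have "gram {{b, c}} w Wh b b = (\<Sum>z\<in>Wh. if z = c then 1 else 0)"
      unfolding gram_def using edge(3)[of "{b, c}"] bc
      by (intro sum.cong refl) (auto simp: adj_def doubleton_eq_iff)
    also have "\<dots> = 1" using assms(3) edge by auto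
    finally show ?thesis
      using det_on_insert_leaf[of "{}" b b "gram {{b, c}} w Wh"] by simp
  qed
  moreover have "{b} \<inter> Bk = {b}" "{c} \<inter> Bk = {}" using edge by auto
  ultimately show ?case
    using bc unfolding UV by (simp add: matchings_no_vertices insert_commute)
next
  case (straight U L b c n E F b' c')
  have V: "insert b' L \<union> insert c' U = insert b' (insert c' (U \<union> L))" by auto
  have IH: "det_on (U \<inter> Bk) (gram E w Wh) = card (matchings E (U \<union> L)) \<and>
      det_on (U \<inter> Bk - {b}) (gram E w Wh) = card (matchings E (U \<union> L - {b, c})) \<and>
      det_on (L \<inter> Bk) (gram E w Wh) = card (matchings E (U \<union> L)) \<and>
      det_on (L \<inter> Bk) (gram E w Wh) - (if n \<in> L then det_on (L \<inter> Bk - {n}) (gram E w Wh) else 0) =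
        card (matchings E (U \<union> L - {b, c}))"
    using straight.prems by (intro straight.IH) auto
  have "insert c' (U \<union> L) - Bk \<subseteq> Wh" using straight.prems(2) by auto
  note D = strip_glue_tile_det[OF straight.hyps refl straight.prems(1) assms(3,4) this]
    and M = strip_glue_tile_matchings[OF straight.hyps refl refl]
  have "insert b' L \<inter> Bk = insert b' (L \<inter> Bk)" "insert c' U \<inter> Bk = U \<inter> Bk"
    "insert b' (L \<inter> Bk) - {b'} = L \<inter> Bk" "b \<in> insert c' U"
    using straight.hyps strip_ends[OF straight.hyps(1)] by auto
  then show ?case
    unfolding V using IH D M by simp
next
  case (pivot U L b c n E F b' c')
  have V: "U \<union> insert b' (insert c' L) = insert b' (insert c' (U \<union> L))" by auto
  have IH: "det_on (U \<inter> Bk) (gram E w Wh) = card (matchings E (U \<union> L)) \<and>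
      det_on (U \<inter> Bk - {b}) (gram E w Wh) = card (matchings E (U \<union> L - {b, c})) \<and>
      det_on (L \<inter> Bk) (gram E w Wh) = card (matchings E (U \<union> L)) \<and>
      det_on (L \<inter> Bk) (gram E w Wh) - (if n \<in> L then det_on (L \<inter> Bk - {n}) (gram E w Wh) else 0) =
        card (matchings E (U \<union> L - {b, c}))"
    using pivot.prems by (intro pivot.IH) auto
  have "insert c' (U \<union> L) - Bk \<subseteq> Wh" using pivot.prems(2) by auto
  note D = strip_glue_tile_det[OF pivot.hyps refl pivot.prems(1) assms(3,4) this]
    and M = strip_glue_tile_matchings[OF pivot.hyps refl refl]
  have "insert b' (insert c' L) \<inter> Bk = insert b' (L \<inter> Bk)"
    "insert b' (L \<inter> Bk) - {b'} = L \<inter> Bk"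
    using pivot.hyps by auto
  then show ?case
    unfolding V using IH D M by simp
qed


section \<open>Chains of tiles\<close>

definition tiles_verts :: "'a tile list \<Rightarrow> 'a set" where
  "tiles_verts ts = (\<Union>t\<in>set ts. set_tile t)"

definition tiles_edges :: "'a tile list \<Rightarrow> 'a set set" where
  "tiles_edges ts = (\<Union>t\<in>set ts. tile_edges t)"

definition tile_cut :: "'a tile list \<Rightarrow> nat \<Rightarrow> 'a set" where
  "tile_cut ts k = tiles_verts (take k ts) \<inter> tiles_verts (drop k ts)"

text \<open>Cuts compare a whole prefix with a whole suffix, not just two neighbouring tiles.
  Requiring them to be edges of both neighbours therefore also says that the tiles at a vertex are
  consecutive. The last condition rules out three tiles glued along one edge.\<close>

definition tile_chain :: "'a tile list \<Rightarrow> bool" where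
  "tile_chain ts \<longleftrightarrow>
     (\<forall>t\<in>set ts. card (set_tile t) = 4) \<and>
     (\<forall>k. 0 < k \<and> k < length ts \<longrightarrow>
        tile_cut ts k \<in> tile_edges (ts ! (k - 1)) \<and> tile_cut ts k \<in> tile_edges (ts ! k)) \<and>
     (\<forall>k. 0 < k \<and> Suc k < length ts \<longrightarrow> tile_cut ts k \<noteq> tile_cut ts (Suc k))"

lemma set_tile_corners: "set_tile t = {sw t, se t, ne t, nw t}"
  by (cases t) simp

lemma tiles_verts_append [simp]: "tiles_verts (xs @ ys) = tiles_verts xs \<union> tiles_verts ys"
  by (auto simp: tiles_verts_def)

lemma tiles_verts_rev [simp]: "tiles_verts (rev ts) = tiles_verts ts"
  by (simp add: tiles_verts_def)

lemma tiles_edges_rev [simp]: "tiles_edges (rev ts) = tiles_edges ts"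
  by (simp add: tiles_edges_def)

lemma set_tile_subset_tiles_verts: "t \<in> set ts \<Longrightarrow> set_tile t \<subseteq> tiles_verts ts"
  by (auto simp: tiles_verts_def)

lemma tile_edges_subset: "e \<in> tile_edges t \<Longrightarrow> e \<subseteq> set_tile t"
  by (auto simp: tile_edges_def set_tile_corners)

lemma card_tile_edge:
  assumes "card (set_tile t) = 4" "e \<in> tile_edges t"
  shows "card e = 2"
proof -
  have "distinct [sw t, se t, ne t, nw t]"
    using assms(1) by (intro card_distinct) (simp add: set_tile_corners)
  then show ?thesis using assms(2) by (auto simp: tile_edges_def)
qed

lemma tile_edges_map_tile: "tile_edges (map_tile f t) = (`) f ` tile_edges t"
  by (cases t) (simp add: tile_edges_def)

lemma tiles_verts_map: "tiles_verts (map (map_tile f) ts) = f ` tiles_verts ts"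
  by (auto simp: tiles_verts_def tile.set_map)

lemma tile_chainD:
  assumes "tile_chain ts"
  shows "t \<in> set ts \<Longrightarrow> card (set_tile t) = 4"
    and "0 < k \<Longrightarrow> k < length ts \<Longrightarrow> tile_cut ts k \<in> tile_edges (ts ! (k - 1))"
    and "0 < k \<Longrightarrow> k < length ts \<Longrightarrow> tile_cut ts k \<in> tile_edges (ts ! k)"
    and "0 < k \<Longrightarrow> Suc k < length ts \<Longrightarrow> tile_cut ts k \<noteq> tile_cut ts (Suc k)"
  using assms by (simp_all add: tile_chain_def)

lemma in_tile_cutI:
  assumes "i < k" "k \<le> j" "j < length ts" "v \<in> set_tile (ts ! i)" "v \<in> set_tile (ts ! j)"
  shows "v \<in> tile_cut ts k"
proof -
  have "ts ! i \<in> set (take k ts)"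
    using assms(1-3) by (auto simp: in_set_conv_nth)
  moreover have "ts ! j \<in> set (drop k ts)"
    using assms(2,3) by (auto simp: in_set_conv_nth intro!: exI[of _ "j - k"])
  ultimately show ?thesis
    using assms(4,5) by (auto simp: tile_cut_def tiles_verts_def)
qed

lemma tile_cut_rev:
  assumes "k \<le> length ts"
  shows "tile_cut (rev ts) k = tile_cut ts (length ts - k)"
  using assms by (simp add: tile_cut_def take_rev drop_rev Int_commute)

text \<open>A rotation may move the tiles before the rotated one; reversal reduces this to moving
  those after it.\<close>

lemma tile_chain_rev:
  assumes "tile_chain ts"
  shows "tile_chain (rev ts)"
  unfolding tile_chain_def
proof (intro conjI allI impI ballI)
  fix t assume "t \<in> set (rev ts)"
  then show "card (set_tile t) = 4" using tile_chainD(1)[OF assms] by simp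
next
  fix k assume k: "0 < k \<and> k < length (rev ts)"
  then have less: "length ts - k < length ts" by auto
  have c: "tile_cut (rev ts) k = tile_cut ts (length ts - k)" using k by (simp add: tile_cut_rev)
  have "rev ts ! (k - 1) = ts ! (length ts - k)" "rev ts ! k = ts ! (length ts - k - 1)"
    using k by (cases k; simp add: rev_nth)+
  then show "tile_cut (rev ts) k \<in> tile_edges (rev ts ! (k - 1))" "tile_cut (rev ts) k \<in> tile_edges (rev ts ! k)"
    using tile_chainD(2,3)[OF assms, of "length ts - k"] k c less by simp_all
next
  fix k assume k: "0 < k \<and> Suc k < length (rev ts)"
  then have "tile_cut (rev ts) k = tile_cut ts (Suc (length ts - Suc k))"
    "tile_cut (rev ts) (Suc k) = tile_cut ts (length ts - Suc k)"
    by (simp_all add: tile_cut_rev Suc_diff_Suc)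
  then show "tile_cut (rev ts) k \<noteq> tile_cut (rev ts) (Suc k)"
    using tile_chainD(4)[OF assms, of "length ts - Suc k"] k by (metis Suc_diff_Suc Suc_lessD
        diff_less length_rev less_trans zero_less_Suc zero_less_diff)
qed

text \<open>Regluing: the tiles \<open>ys\<close> are detached from the edge \<open>CD\<close> of the last tile of \<open>xs\<close> and attached
  to its edge \<open>AB\<close> instead.\<close>

lemma tile_chain_reglue:
  assumes chain: "tile_chain (xs @ ys)" and ne: "xs \<noteq> []" "ys \<noteq> []"
    and CD: "tile_cut (xs @ ys) (length xs) = {C, D}"
    and AB: "{A, B} \<in> tile_edges (last xs)" "A \<notin> tiles_verts ys" "B \<notin> tiles_verts ys"
    and f: "inj_on f (tiles_verts ys)" "f C = A" "f D = B"
      "\<And>v. v \<in> tiles_verts ys \<Longrightarrow> v \<noteq> C \<Longrightarrow> v \<noteq> D \<Longrightarrow> f v = v"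
    and cut_AB: "1 < length xs \<Longrightarrow> tile_cut (xs @ ys) (length xs - 1) \<noteq> {A, B}"
  shows "tile_chain (xs @ map (map_tile f) ys)"
    and "tiles_verts xs \<inter> tiles_verts ys = {C, D}"
proof -
  let ?m = "length xs" and ?ts = "xs @ ys" and ?zs = "xs @ map (map_tile f) ys"
  let ?X = "tiles_verts xs" and ?Y = "tiles_verts ys"
  have XY: "?X \<inter> ?Y = {C, D}"
    using CD by (simp add: tile_cut_def)
  then show "?X \<inter> ?Y = {C, D}" .
  have CDY: "C \<in> ?Y" "D \<in> ?Y" using XY by auto
  have m: "0 < ?m" "?m < length ?ts" using ne by auto
  have CD_last: "{C, D} \<subseteq> set_tile (last xs)"
    using tile_chainD(2)[OF chain m] CD tile_edges_subset m
    by (simp add: nth_append last_conv_nth ne) blast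
  have CD_hd: "{C, D} \<subseteq> set_tile (hd ys)"
    using tile_chainD(3)[OF chain m] CD tile_edges_subset
    by (simp add: nth_append hd_conv_nth ne) blast
  have AB_last: "{A, B} \<subseteq> set_tile (last xs)"
    using AB(1) by (rule tile_edges_subset)
  have ABX: "A \<in> ?X" "B \<in> ?X"
    using AB_last ne(1) by (auto simp: tiles_verts_def)
  have fY: "f v = A \<or> f v = B \<or> f v = v \<and> v \<noteq> C \<and> v \<noteq> D" if "v \<in> ?Y" for v
    using f(2-4) that by blast
  have XfY: "?X \<inter> f ` ?Y = {A, B}"
  proof
    show "?X \<inter> f ` ?Y \<subseteq> {A, B}" using fY XY by fastforce
    show "{A, B} \<subseteq> ?X \<inter> f ` ?Y" using ABX CDY f(2,3) by blast
  qed
  \<comment> \<open>All that \<open>xs\<close> shares with the moved tiles, before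
    (\<open>C\<close>, \<open>D\<close>) and after (\<open>A\<close>, \<open>B\<close>), lies on the
    last tile of \<open>xs\<close>, which is already in the suffix. The moved tiles thus add nothing
    to these cuts.\<close>
  have low: "tile_cut ?zs k = tile_cut ?ts k" if k: "k < ?m" for k
  proof -
    have "last xs \<in> set (drop k xs)" using k by (metis drop_eq_Nil last_drop last_in_set not_le)
    then have last: "set_tile (last xs) \<subseteq> tiles_verts (drop k xs)"
      by (rule set_tile_subset_tiles_verts)
    have sub: "tiles_verts (take k xs) \<subseteq> ?X"
      by (auto simp: tiles_verts_def dest: in_set_takeD)
    have "tile_cut ?zs k = tiles_verts (take k xs) \<inter> tiles_verts (drop k xs)"
    proof -
      have "tiles_verts (take k xs) \<inter> f ` ?Y \<subseteq> {A, B}"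
        using Int_mono[OF sub order_refl, of "f ` ?Y"] unfolding XfY .
      also have "\<dots> \<subseteq> tiles_verts (drop k xs)"
        using AB_last last by (rule order_trans)
      finally show ?thesis
        using k by (auto simp: tile_cut_def tiles_verts_map)
    qed
    moreover have "tile_cut ?ts k = tiles_verts (take k xs) \<inter> tiles_verts (drop k xs)"
    proof -
      have "tiles_verts (take k xs) \<inter> ?Y \<subseteq> {C, D}"
        using Int_mono[OF sub order_refl, of ?Y] unfolding XY .
      also have "\<dots> \<subseteq> tiles_verts (drop k xs)"
        using CD_last last by (rule order_trans)
      finally show ?thesis
        using k by (auto simp: tile_cut_def)
    qed
    ultimately show ?thesis by simp
  qed
  have mid: "tile_cut ?zs ?m = {A, B}"
    using XfY by (simp add: tile_cut_def tiles_verts_map)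
  \<comment> \<open>Dually, the first moved tile is now in the prefix and contains every vertex
    shared with \<open>xs\<close>, so the later cuts are merely relabelled by
    \<open>f\<close>.\<close>
  have high: "tile_cut ?zs (?m + j) = f ` tile_cut ?ts (?m + j) \<and> tile_cut ?ts (?m + j) \<subseteq> ?Y"
    if j: "0 < j" for j
  proof -
    have "hd ys \<in> set (take j ys)" using j ne(2) by (cases ys; cases j) auto
    then have hd: "set_tile (hd ys) \<subseteq> tiles_verts (take j ys)"
      by (rule set_tile_subset_tiles_verts)
    have sub: "tiles_verts (drop j ys) \<subseteq> ?Y" "tiles_verts (take j ys) \<subseteq> ?Y"
      by (auto simp: tiles_verts_def dest: in_set_takeD in_set_dropD)
    have AB': "{A, B} \<subseteq> f ` tiles_verts (take j ys)"
      using hd CD_hd f(2,3) by blast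
    have "tile_cut ?zs (?m + j) =
        (?X \<union> f ` tiles_verts (take j ys)) \<inter> f ` tiles_verts (drop j ys)"
      by (simp add: tile_cut_def tiles_verts_map take_map drop_map)
    also have "\<dots> = f ` tiles_verts (take j ys) \<inter> f ` tiles_verts (drop j ys)"
    proof -
      have "?X \<inter> f ` tiles_verts (drop j ys) \<subseteq> {A, B}"
        using Int_mono[OF order_refl image_mono[OF sub(1)], of ?X f] unfolding XfY .
      then show ?thesis using AB' by auto
    qed
    also have "\<dots> = f ` (tiles_verts (take j ys) \<inter> tiles_verts (drop j ys))"
      using inj_on_image_Int[OF f(1) sub(2,1)] by simp
    also have "tiles_verts (take j ys) \<inter> tiles_verts (drop j ys) = tile_cut ?ts (?m + j)"
    proof -
      have "?X \<inter> tiles_verts (drop j ys) \<subseteq> {C, D}"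
        using Int_mono[OF order_refl sub(1), of ?X] unfolding XY .
      also have "\<dots> \<subseteq> tiles_verts (take j ys)"
        using CD_hd hd by (rule order_trans)
      finally show ?thesis by (auto simp: tile_cut_def)
    qed
    finally show ?thesis
      using sub(1) by (auto simp: tile_cut_def)
  qed
  show "tile_chain ?zs"
    unfolding tile_chain_def
  proof (intro conjI allI impI ballI)
    fix t assume "t \<in> set ?zs"
    then consider "t \<in> set xs" | s where "s \<in> set ys" "t = map_tile f s"
      by auto
    then show "card (set_tile t) = 4"
    proof cases
      case 2
      have "inj_on f (set_tile s)"
        using f(1) set_tile_subset_tiles_verts[OF 2(1)] by (rule inj_on_subset)
      then show ?thesis
        using tile_chainD(1)[OF chain, of s] 2 by (simp add: tile.set_map card_image)
    qed (use tile_chainD(1)[OF chain, of t] in simp)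
  next
    fix k assume k: "0 < k \<and> k < length ?zs"
    then have old: "tile_cut ?ts k \<in> tile_edges (?ts ! (k - 1))" "tile_cut ?ts k \<in> tile_edges (?ts ! k)"
      using tile_chainD(2,3)[OF chain, of k] by auto
    consider "k < ?m" | "k = ?m" | j where "k = ?m + j" "0 < j"
      by (metis less_imp_add_positive linorder_neqE_nat)
    then have "tile_cut ?zs k \<in> tile_edges (?zs ! (k - 1)) \<and> tile_cut ?zs k \<in> tile_edges (?zs ! k)"
    proof cases
      case 1
      then have "k - 1 < ?m" by simp
      then show ?thesis using old low[OF 1] 1 by (simp add: nth_append)
    next
      case 2
      have "f ` {C, D} = {A, B}" using f(2,3) by simp
      moreover have "{C, D} \<in> tile_edges (ys ! 0)"
        using old(2) CD 2 by (simp add: nth_append)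
      ultimately have "{A, B} \<in> tile_edges (map_tile f (ys ! 0))"
        unfolding tile_edges_map_tile by (intro image_eqI[of _ _ "{C, D}"]) auto
      then show ?thesis
        using AB(1) mid ne 2 k by (simp add: nth_append last_conv_nth)
    next
      case 3
      then have "j < length ys" using k by simp
      moreover have "\<not> k - 1 < ?m" "k - 1 - ?m = j - 1" "j - 1 < length ys"
        using 3 k by auto
      ultimately show ?thesis
        using old high[OF 3(2)] 3 by (auto simp: nth_append tile_edges_map_tile)
    qed
    then show "tile_cut ?zs k \<in> tile_edges (?zs ! (k - 1))" "tile_cut ?zs k \<in> tile_edges (?zs ! k)"
      by simp_all
  next
    fix k assume k: "0 < k \<and> Suc k < length ?zs"
    then have old: "tile_cut ?ts k \<noteq> tile_cut ?ts (Suc k)"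
      using tile_chainD(4)[OF chain, of k] by auto
    consider "Suc k < ?m" | "Suc k = ?m" | "k = ?m" | j where "k = ?m + j" "0 < j"
      by (metis Suc_lessI less_imp_add_positive linorder_neqE_nat)
    then show "tile_cut ?zs k \<noteq> tile_cut ?zs (Suc k)"
    proof cases
      case 1
      then show ?thesis using old low[of k] low[of "Suc k"] by simp
    next
      case 2
      then have "k = ?m - 1" "k < ?m" "1 < ?m" using k by auto
      then show ?thesis using cut_AB low[of k] mid 2 by simp
    next
      case 3
      have "f ` {C, D} = {A, B}" using f(2,3) by simp
      then have "tile_cut ?zs k = f ` tile_cut ?ts k" using mid CD 3 by simp
      moreover have "tile_cut ?ts k \<subseteq> ?Y" using CD CDY 3 by simp
      ultimately show ?thesis
        using inj_on_image_eq_iff[OF f(1), of "tile_cut ?ts k" "tile_cut ?ts (Suc k)"] old high[of 1] 3 by simp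
    next
      case 4
      then show ?thesis
        using inj_on_image_eq_iff[OF f(1), of "tile_cut ?ts k" "tile_cut ?ts (Suc k)"] old
          high[of j] high[of "Suc j"] by simp
    qed
  qed
qed


subsection \<open>Snake graphs\<close>

lemma set_unit_tile:
  "set_tile (unit_tile p) =
     {p, (fst p + 1, snd p), (fst p + 1, snd p + 1), (fst p, snd p + 1)}"
  by (cases p) (simp add: unit_tile_def insert_commute)

lemma tile_edges_unit_tile:
  "tile_edges (unit_tile p) =
     {{p, (fst p + 1, snd p)}, {(fst p + 1, snd p), (fst p + 1, snd p + 1)},
      {(fst p + 1, snd p + 1), (fst p, snd p + 1)}, {(fst p, snd p + 1), p}}"
  by (cases p) (simp add: unit_tile_def tile_edges_def)

text \<open>The sum of the coordinates of the lower left corner grows by one from tile to tile and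
  varies by two within a tile. Tiles more than two steps apart are hence disjoint, and tiles two
  steps apart can meet only in the lower left corner of the later one, which also belongs to the
  tile between them.\<close>

lemma tile_chain_snake:
  assumes step: "\<And>i. Suc i < length ps \<Longrightarrow>
      ps ! Suc i = (fst (ps ! i) + 1, snd (ps ! i)) \<or>
      ps ! Suc i = (fst (ps ! i), snd (ps ! i) + 1)"
  shows "tile_chain (map unit_tile ps)"
proof -
  let ?T = "\<lambda>i. set_tile (unit_tile (ps ! i))" and ?ts = "map unit_tile ps"
  let ?s = "\<lambda>p :: real \<times> real. fst p + snd p"
  have level: "?s (ps ! i) = ?s (ps ! 0) + real i" if "i < length ps" for i
    using that
  proof (induction i)
    case (Suc i)
    then show ?case using step[of i] by auto
  qed simp
  have convex: "v \<in> ?T k" if "i \<le> k" "k \<le> j" "j < length ps" "v \<in> ?T i" "v \<in> ?T j" for i j k v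
  proof (cases "k = i \<or> k = j")
    case False
    have "?s v \<le> ?s (ps ! i) + 2" "?s v \<ge> ?s (ps ! j)"
      using that(4,5) by (auto simp: set_unit_tile)
    then have "j \<le> i + 2"
      using level[of i] level[of j] that(1-3) by simp
    then have k: "k = Suc i" and j: "j = Suc k" using False that(1,2) by auto
    then have "?s v = ?s (ps ! j)"
      using \<open>?s v \<le> ?s (ps ! i) + 2\<close> \<open>?s v \<ge> ?s (ps ! j)\<close> level[of i] level[of j] that(1-3) by simp
    then have "v = ps ! j"
      using that(5) by (auto simp: set_unit_tile)
    then show ?thesis
      using step[of k] j that(3) by (auto simp: set_unit_tile)
  qed (use that in auto)
  have tile_cut: "tile_cut ?ts k = ?T (k - 1) \<inter> ?T k" if k: "0 < k" "k < length ps" for k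
  proof
    show "tile_cut ?ts k \<subseteq> ?T (k - 1) \<inter> ?T k"
    proof
      fix v assume "v \<in> tile_cut ?ts k"
      then obtain i j where "i < k" "v \<in> ?T i" "j < length ps - k" "v \<in> ?T (k + j)"
        using k by (auto simp: tile_cut_def tiles_verts_def in_set_conv_nth)
      then show "v \<in> ?T (k - 1) \<inter> ?T k"
        using convex[of i "k - 1" "k + j" v] convex[of i k "k + j" v] k by auto
    qed
    show "?T (k - 1) \<inter> ?T k \<subseteq> tile_cut ?ts k"
      using in_tile_cutI[of "k - 1" k k ?ts] k by auto
  qed
  \<comment> \<open>The two facts about lower left corners separate consecutive cuts: the corner of
    a tile lies in the cut before it and not in the cut after it.\<close>
  have edge: "tile_cut ?ts (Suc k) \<in> tile_edges (?ts ! k) \<and> tile_cut ?ts (Suc k) \<in> tile_edges (?ts ! Suc k) \<and>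
      ps ! k \<notin> tile_cut ?ts (Suc k) \<and> ps ! Suc k \<in> tile_cut ?ts (Suc k)"
    if k: "Suc k < length ps" for k
  proof -
    obtain x y where p: "ps ! k = (x, y)" by (cases "ps ! k")
    have c: "tile_cut ?ts (Suc k) = ?T k \<inter> ?T (Suc k)" using tile_cut[of "Suc k"] k by simp
    from step[OF k] show ?thesis
    proof
      assume q: "ps ! Suc k = (fst (ps ! k) + 1, snd (ps ! k))"
      then have "tile_cut ?ts (Suc k) = {(x + 1, y), (x + 1, y + 1)}"
        unfolding c by (auto simp: set_unit_tile p)
      then show ?thesis
        using k q p by (simp add: tile_edges_unit_tile insert_commute)
    next
      assume q: "ps ! Suc k = (fst (ps ! k), snd (ps ! k) + 1)"
      then have "tile_cut ?ts (Suc k) = {(x, y + 1), (x + 1, y + 1)}"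
        unfolding c by (auto simp: set_unit_tile p)
      then show ?thesis
        using k q p by (simp add: tile_edges_unit_tile insert_commute)
    qed
  qed
  show ?thesis
    unfolding tile_chain_def
  proof (intro conjI allI impI ballI)
    fix t assume "t \<in> set ?ts"
    then show "card (set_tile t) = 4" by (auto simp: set_unit_tile)
  next
    fix k assume "0 < k \<and> k < length ?ts"
    then show "tile_cut ?ts k \<in> tile_edges (?ts ! (k - 1))" "tile_cut ?ts k \<in> tile_edges (?ts ! k)"
      using edge[of "k - 1"] by simp_all
  next
    fix k assume k: "0 < k \<and> Suc k < length ?ts"
    then have "ps ! k \<in> tile_cut ?ts k" "ps ! k \<notin> tile_cut ?ts (Suc k)"
      using edge[of "k - 1"] edge[of k] by simp_all
    then show "tile_cut ?ts k \<noteq> tile_cut ?ts (Suc k)" by blast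
  qed
qed


subsection \<open>Rotations\<close>

lemma card_4_corners:
  assumes "card (set_tile t) = 4"
  shows "distinct [sw t, se t, ne t, nw t]"
  using assms by (intro card_distinct) (simp add: set_tile_corners)

text \<open>After deleting vertices of one edge of a 4-cycle, the other three edges still connect
  the rest. Connectedness is phrased through functions that are constant along edges, because it is
  applied to membership in \<open>V2\<close>.\<close>

lemma tile_minus_edge_connected:
  assumes t: "card (set_tile t) = 4" and e: "e \<in> tile_edges t" and S: "S \<subseteq> e"
    and P: "\<And>u v. {u, v} \<in> tile_edges t \<Longrightarrow> u \<notin> S \<Longrightarrow> v \<notin> S \<Longrightarrow> P u = P v"
    and u: "u \<in> set_tile t - S" and v: "v \<in> set_tile t - S"
  shows "P u = P v"
proof -
  have path: "P u = P v"
    if abcd: "set_tile t = {a, b, c, d}" "distinct [a, b, c, d]" "S \<subseteq> {a, b}"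
      and edges: "{b, c} \<in> tile_edges t" "{c, d} \<in> tile_edges t" "{d, a} \<in> tile_edges t"
    for a b c d
  proof -
    have cd: "c \<notin> S" "d \<notin> S" using abcd(2,3) by auto
    have "P x = P c" if "x \<in> set_tile t - S" for x
      using that P[OF edges(1)] P[OF edges(2)] P[OF edges(3)] cd unfolding abcd(1) by auto
    then show ?thesis using u v by simp
  qed
  note D = card_4_corners[OF t] and E = tile_edges_def[of t] and C = set_tile_corners[of t]
  from e consider "e = {sw t, se t}" | "e = {se t, ne t}" | "e = {ne t, nw t}" | "e = {nw t, sw t}"
    unfolding E by blast
  then show ?thesis
  proof cases
    case 1
    show ?thesis by (rule path[of "sw t" "se t" "ne t" "nw t"]) (use D S 1 in \<open>auto simp: E C\<close>)
  next
    case 2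
    show ?thesis by (rule path[of "se t" "ne t" "nw t" "sw t"]) (use D S 2 in \<open>auto simp: E C\<close>)
  next
    case 3
    show ?thesis by (rule path[of "ne t" "nw t" "sw t" "se t"]) (use D S 3 in \<open>auto simp: E C\<close>)
  next
    case 4
    show ?thesis by (rule path[of "nw t" "sw t" "se t" "ne t"]) (use D S 4 in \<open>auto simp: E C\<close>)
  qed
qed

lemma tile_edge_other_neighbour:
  assumes "card (set_tile t) = 4" "e \<in> tile_edges t" "u \<in> e"
  obtains x where "x \<in> set_tile t" "x \<notin> e" "{u, x} \<in> tile_edges t"
proof -
  note other = that
  have step: thesis
    if abcd: "set_tile t = {a, b, c, d}" "distinct [a, b, c, d]" "e = {a, b}"
      and edges: "{b, c} \<in> tile_edges t" "{d, a} \<in> tile_edges t" for a b c d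
  proof (cases "u = a")
    case True
    then show ?thesis using other[of d] abcd edges(2) by (auto simp: insert_commute)
  next
    case False
    then have "u = b" using assms(3) abcd(3) by simp
    then show ?thesis using other[of c] abcd edges(1) by auto
  qed
  note D = card_4_corners[OF assms(1)] and E = tile_edges_def[of t] and C = set_tile_corners[of t]
  from assms(2) consider "e = {sw t, se t}" | "e = {se t, ne t}" | "e = {ne t, nw t}" | "e = {nw t, sw t}"
    unfolding E by blast
  then show ?thesis
  proof cases
    case 1
    show ?thesis by (rule step[of "sw t" "se t" "ne t" "nw t"]) (use D 1 in \<open>auto simp: E C\<close>)
  next
    case 2
    show ?thesis by (rule step[of "se t" "ne t" "nw t" "sw t"]) (use D 2 in \<open>auto simp: E C\<close>)
  next
    case 3
    show ?thesis by (rule step[of "ne t" "nw t" "sw t" "se t"]) (use D 3 in \<open>auto simp: E C\<close>)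
  next
    case 4
    show ?thesis by (rule step[of "nw t" "sw t" "se t" "ne t"]) (use D 4 in \<open>auto simp: E C\<close>)
  qed
qed

lemma tile_chain_inter_subset_cut:
  assumes "m < j" "j < length ts"
  shows "set_tile (ts ! j) \<inter> set_tile (ts ! m) \<subseteq> tile_cut ts j"
  using in_tile_cutI[of m j j ts] assms by auto

text \<open>Neighbouring tiles after tile \<open>m\<close> overlap in a vertex outside tile
  \<open>m\<close>, and each of them stays connected without tile \<open>m\<close>, because they
  lose at most the vertices of one edge.\<close>

lemma tile_chain_beyond_connected:
  assumes chain: "tile_chain ts"
    and P: "\<And>t u v. t \<in> set ts \<Longrightarrow> {u, v} \<in> tile_edges t \<Longrightarrow>
      u \<notin> set_tile (ts ! m) \<Longrightarrow> v \<notin> set_tile (ts ! m) \<Longrightarrow> P u = P v"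
    and ij: "m < i" "i \<le> j" "j < length ts"
    and u: "u \<in> set_tile (ts ! i) - set_tile (ts ! m)"
    and v: "v \<in> set_tile (ts ! j) - set_tile (ts ! m)"
  shows "P u = P v"
  using ij(2,3) v
proof (induction j arbitrary: v rule: dec_induct)
  case base
  have i: "ts ! i \<in> set ts" using ij by simp
  show ?case
  proof (rule tile_minus_edge_connected[where P = P])
    show "card (set_tile (ts ! i)) = 4" using tile_chainD(1)[OF chain i] .
    show "tile_cut ts i \<in> tile_edges (ts ! i)" using tile_chainD(3)[OF chain, of i] ij by simp
    show "set_tile (ts ! i) \<inter> set_tile (ts ! m) \<subseteq> tile_cut ts i"
      using tile_chain_inter_subset_cut[of m i ts] ij by simp
    show "P x = P y" if "{x, y} \<in> tile_edges (ts ! i)" "x \<notin> set_tile (ts ! i) \<inter> set_tile (ts ! m)"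
      "y \<notin> set_tile (ts ! i) \<inter> set_tile (ts ! m)" for x y
      using P[OF i that(1)] tile_edges_subset[OF that(1)] that(2,3) by simp
  qed (use u base in auto)
next
  case (step j)
  have j: "m < j" "Suc j < length ts" using step.hyps step.prems ij by auto
  have js: "ts ! Suc j \<in> set ts" "ts ! j \<in> set ts" using j by auto
  let ?Q = "set_tile (ts ! m)"
  have cuts: "tile_cut ts (Suc j) \<in> tile_edges (ts ! j)"
    "tile_cut ts (Suc j) \<in> tile_edges (ts ! Suc j)" "tile_cut ts j \<in> tile_edges (ts ! j)"
    using tile_chainD(2,3)[OF chain, of "Suc j"] tile_chainD(3)[OF chain, of j] j by auto
  \<comment> \<open>Otherwise this cut would be contained in the preceding one, and equal to it
    since both have two elements.\<close>
  have "\<not> tile_cut ts (Suc j) \<subseteq> ?Q"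
  proof
    assume "tile_cut ts (Suc j) \<subseteq> ?Q"
    then have sub: "tile_cut ts (Suc j) \<subseteq> tile_cut ts j"
      using tile_edges_subset[OF cuts(1)] tile_chain_inter_subset_cut[of m j ts] j by auto
    have "card (tile_cut ts (Suc j)) = 2" "card (tile_cut ts j) = 2"
      using card_tile_edge[OF tile_chainD(1)[OF chain js(2)]] cuts by auto
    then have "tile_cut ts (Suc j) = tile_cut ts j"
      using sub by (intro card_subset_eq) (auto intro: card_ge_0_finite)
    then show False
      using tile_chainD(4)[OF chain, of j] j by simp
  qed
  then obtain x where x: "x \<in> tile_cut ts (Suc j)" "x \<notin> ?Q" by blast
  have "P x = P v"
  proof (rule tile_minus_edge_connected[where P = P])
    show "card (set_tile (ts ! Suc j)) = 4" using tile_chainD(1)[OF chain js(1)] .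
    show "tile_cut ts (Suc j) \<in> tile_edges (ts ! Suc j)" using cuts by simp
    show "set_tile (ts ! Suc j) \<inter> ?Q \<subseteq> tile_cut ts (Suc j)"
      using tile_chain_inter_subset_cut[of m "Suc j" ts] j by simp
    show "P x = P y" if "{x, y} \<in> tile_edges (ts ! Suc j)" "x \<notin> set_tile (ts ! Suc j) \<inter> ?Q"
      "y \<notin> set_tile (ts ! Suc j) \<inter> ?Q" for x y
      using P[OF js(1) that(1)] tile_edges_subset[OF that(1)] that(2,3) by simp
    show "x \<in> set_tile (ts ! Suc j) - set_tile (ts ! Suc j) \<inter> ?Q"
      using x tile_edges_subset[OF cuts(2)] by auto
    show "v \<in> set_tile (ts ! Suc j) - set_tile (ts ! Suc j) \<inter> ?Q"
      using step.prems by auto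
  qed
  moreover have "P u = P x"
    using step.IH[of x] x tile_edges_subset[OF cuts(1)] j by auto
  ultimately show ?case by simp
qed

text \<open>One of the two blocks that a rotation at tile \<open>m\<close> can move; the block
  before tile \<open>m\<close> is obtained from the reversed list.\<close>

definition beyond :: "'a tile list \<Rightarrow> nat \<Rightarrow> 'a set" where
  "beyond ts m = tiles_verts (drop (Suc m) ts) - set_tile (ts ! m)"

lemma in_beyondE:
  assumes "v \<in> beyond ts m"
  obtains j where "m < j" "j < length ts" "v \<in> set_tile (ts ! j) - set_tile (ts ! m)"
proof -
  obtain j where "j < length ts - Suc m" "v \<in> set_tile (ts ! (Suc m + j))" "v \<notin> set_tile (ts ! m)"
    using assms by (auto simp: beyond_def tiles_verts_def in_set_conv_nth)
  then show ?thesis using that[of "Suc m + j"] by simp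
qed

lemma in_beyondI:
  assumes "m < j" "j < length ts" "v \<in> set_tile (ts ! j)" "v \<notin> set_tile (ts ! m)"
  shows "v \<in> beyond ts m"
proof -
  have "ts ! j \<in> set (drop (Suc m) ts)"
    using assms(1,2) by (auto simp: in_set_conv_nth intro!: exI[of _ "j - Suc m"])
  then show ?thesis using assms(3,4) by (auto simp: beyond_def tiles_verts_def)
qed

lemma tile_chain_beyond_uniform:
  assumes "tile_chain ts"
    and "\<And>t u v. t \<in> set ts \<Longrightarrow> {u, v} \<in> tile_edges t \<Longrightarrow>
      u \<notin> set_tile (ts ! m) \<Longrightarrow> v \<notin> set_tile (ts ! m) \<Longrightarrow> P u = P v"
    and "u \<in> beyond ts m" "v \<in> beyond ts m"
  shows "P u = P v"
proof -
  obtain i where i: "m < i" "i < length ts" "u \<in> set_tile (ts ! i) - set_tile (ts ! m)"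
    using assms(3) by (rule in_beyondE)
  obtain j where j: "m < j" "j < length ts" "v \<in> set_tile (ts ! j) - set_tile (ts ! m)"
    using assms(4) by (rule in_beyondE)
  show ?thesis
  proof (cases "i \<le> j")
    case True
    show ?thesis
      by (rule tile_chain_beyond_connected[where P = P, OF assms(1) _ i(1) True j(2) i(3) j(3)])
        (rule assms(2))
  next
    case False
    then have ji: "j \<le> i" by simp
    have "P v = P u"
      by (rule tile_chain_beyond_connected[where P = P, OF assms(1) _ j(1) ji i(2) j(3) i(3)])
        (rule assms(2))
    then show ?thesis ..
  qed
qed

text \<open>Each vertex of the cut has a second neighbour in the next tile, off the cut and hence
  beyond tile \<open>m\<close>. So the whole cut lies in \<open>X\<close>, and counting gives
  equality.\<close>

lemma tile_chain_cut_eq: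
  assumes chain: "tile_chain ts" and m: "Suc m < length ts" and X: "card X \<le> 2" "finite X"
    and nb: "\<And>t u x. t \<in> set ts \<Longrightarrow> u \<in> set_tile (ts ! m) \<Longrightarrow> x \<in> beyond ts m \<Longrightarrow>
      {u, x} \<in> tile_edges t \<Longrightarrow> u \<in> X"
  shows "tile_cut ts (Suc m) = X"
proof -
  have t: "ts ! Suc m \<in> set ts" using m by simp
  have t4: "card (set_tile (ts ! Suc m)) = 4" using tile_chainD(1)[OF chain t] .
  have cuts: "tile_cut ts (Suc m) \<in> tile_edges (ts ! m)" "tile_cut ts (Suc m) \<in> tile_edges (ts ! Suc m)"
    using tile_chainD(2,3)[OF chain, of "Suc m"] m by auto
  have "tile_cut ts (Suc m) \<subseteq> X"
  proof
    fix u assume u: "u \<in> tile_cut ts (Suc m)"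
    obtain x where x: "x \<in> set_tile (ts ! Suc m)" "x \<notin> tile_cut ts (Suc m)"
        "{u, x} \<in> tile_edges (ts ! Suc m)"
      using tile_edge_other_neighbour[OF t4 cuts(2) u] .
    have "x \<notin> set_tile (ts ! m)"
      using tile_chain_inter_subset_cut[of m "Suc m" ts] x m by auto
    then have "x \<in> beyond ts m"
      using x(1) m by (intro in_beyondI) auto
    moreover have "u \<in> set_tile (ts ! m)"
      using u tile_edges_subset[OF cuts(1)] by blast
    ultimately show "u \<in> X" using nb[OF t] x(3) by blast
  qed
  moreover have "card (tile_cut ts (Suc m)) = 2"
    using card_tile_edge[OF t4 cuts(2)] .
  ultimately show ?thesis
    using X by (intro card_seteq) auto
qed

section \<open>Invariance of tile chains under rotation\<close>

definition chain_graph :: "'a tiled_graph \<Rightarrow> bool" where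
  "chain_graph G \<longleftrightarrow> tiles G \<noteq> [] \<and> tile_chain (tiles G) \<and>
     verts G = tiles_verts (tiles G) \<and> edges G = tiles_edges (tiles G)"


lemma chain_graph_rev:
  "chain_graph (G\<lparr>tiles := rev (tiles G)\<rparr>) \<longleftrightarrow> chain_graph G"
  using tile_chain_rev[of "tiles G"] tile_chain_rev[of "rev (tiles G)"]
  by (auto simp: chain_graph_def)

lemma rotate_rev:
  "rotate (G\<lparr>tiles := rev (tiles G)\<rparr>) A B C D V2 =
     (rotate G A B C D V2)\<lparr>tiles := rev (tiles (rotate G A B C D V2))\<rparr>"
  by (simp add: rotate_def Let_def rev_map)

lemma rotate_empty: "rotate G A B C D {} = G"
proof -
  have "rotate_tile A B C D {} = id"
    by (auto simp: rotate_tile_def)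
  then show ?thesis by (cases G) (simp add: rotate_def)
qed

text \<open>The later tiles are exactly those meeting \<open>V2\<close>: outside \<open>V2\<close>
  they have only \<open>C\<close> and \<open>D\<close>, which cannot make up four corners. The
  rotation is thus a regluing of these tiles from \<open>CD\<close> to \<open>AB\<close>. The
  assumption on \<open>BC\<close> keeps \<open>AB\<close> free of the tiles before tile
  \<open>m\<close>.\<close>

lemma chain_graph_rotate_beyond:
  assumes G: "chain_graph G" and m: "Suc m < length (tiles G)"
    and Q: "set_tile (tiles G ! m) = {A, B, C, D}" "distinct [A, B, C, D]"
    and edges: "tile_edges (tiles G ! m) = {{A, B}, {B, C}, {C, D}, {D, A}}"
    and CD: "tile_cut (tiles G) (Suc m) = {C, D}"
    and BC: "0 < m \<Longrightarrow> tile_cut (tiles G) m = {B, C}"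
  shows "chain_graph (rotate G A B C D (beyond (tiles G) m))"
proof -
  let ?ts = "tiles G" and ?V2 = "beyond (tiles G) m"
  define xs ys where "xs = take (Suc m) ?ts" and "ys = drop (Suc m) ?ts"
  define f where "f = (\<lambda>v. if v = D then B else if v = C then A else v)"
  have chain: "tile_chain ?ts" and Gv: "verts G = tiles_verts ?ts" and Ge: "edges G = tiles_edges ?ts"
    using G by (auto simp: chain_graph_def)
  have ts: "?ts = xs @ ys" by (simp add: xs_def ys_def)
  have ne: "xs \<noteq> []" "ys \<noteq> []" and len: "length xs = Suc m"
    using m by (auto simp: xs_def ys_def)
  have last: "last xs = ?ts ! m"
    using m by (simp add: xs_def take_Suc_conv_app_nth)
  have Y: "tiles_verts ys = ?V2 \<union> {C, D}" and V2Q: "?V2 \<inter> {A, B, C, D} = {}"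
    and XY: "tiles_verts xs \<inter> tiles_verts ys = {C, D}"
  proof -
    show XY: "tiles_verts xs \<inter> tiles_verts ys = {C, D}"
      using CD by (simp add: tile_cut_def xs_def ys_def)
    have "{A, B, C, D} \<subseteq> tiles_verts xs"
      using Q(1) set_tile_subset_tiles_verts[OF last_in_set[OF ne(1)]] last by simp
    then have "tiles_verts ys \<inter> {A, B, C, D} = {C, D}"
      using XY by blast
    moreover have V2: "?V2 = tiles_verts ys - {A, B, C, D}"
      by (simp add: beyond_def ys_def Q(1))
    ultimately show "tiles_verts ys = ?V2 \<union> {C, D}" by blast
    show "?V2 \<inter> {A, B, C, D} = {}" using V2 by blast
  qed
  have dist: "A \<noteq> B" "A \<noteq> C" "A \<noteq> D" "B \<noteq> C" "B \<noteq> D" "C \<noteq> D"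
    using Q(2) by auto
  have notY: "A \<notin> tiles_verts ys" "B \<notin> tiles_verts ys"
    using Y V2Q dist by auto
  have fv: "f C = A" "f D = B" "\<And>v. v \<noteq> C \<Longrightarrow> v \<noteq> D \<Longrightarrow> f v = v"
    using dist by (auto simp: f_def)
  have inj: "inj_on f (tiles_verts ys)"
    using notY dist by (auto simp: inj_on_def f_def)
  have f_sub: "f ` e = e" if "e \<subseteq> ?V2" for e
  proof -
    have "f v = v" if "v \<in> e" for v
    proof (rule fv(3))
      show "v \<noteq> C" "v \<noteq> D" using that \<open>e \<subseteq> ?V2\<close> V2Q by blast+
    qed
    then show ?thesis by simp
  qed
  have fY: "f ` tiles_verts ys = ?V2 \<union> {A, B}"
  proof -
    have "f ` {C, D} = {A, B}" using fv(1,2) by simp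
    then show ?thesis unfolding Y image_Un by (simp only: f_sub[OF order_refl])
  qed
  have xs_old: "set_tile t \<inter> ?V2 = {}" if "t \<in> set xs" for t
  proof (rule equals0I)
    fix v assume "v \<in> set_tile t \<inter> ?V2"
    then have v: "v \<in> tiles_verts xs" "v \<in> ?V2"
      using set_tile_subset_tiles_verts[OF that] by auto
    then have "v \<in> tiles_verts xs \<inter> tiles_verts ys" by (simp add: Y)
    then have "v \<in> {C, D}" by (simp only: XY)
    then show False using v(2) V2Q by auto
  qed
  have ys_new: "set_tile t \<inter> ?V2 \<noteq> {}" if t: "t \<in> set ys" for t
  proof
    assume "set_tile t \<inter> ?V2 = {}"
    then have "set_tile t \<subseteq> {C, D}"
      using set_tile_subset_tiles_verts[OF t] Y by blast
    then have "card (set_tile t) \<le> card {C, D}"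
      by (intro card_mono) auto
    then show False
      using tile_chainD(1)[OF chain, of t] t dist by (simp add: ts)
  qed
  have split: "map r ?ts = map r xs @ map r ys" for r :: "'a tile \<Rightarrow> 'a tile"
    by (simp only: ts map_append)
  have tiles: "map (rotate_tile A B C D ?V2) ?ts = xs @ map (map_tile f) ys"
    unfolding split
  proof (intro arg_cong2[where f = "(@)"])
    show "map (rotate_tile A B C D ?V2) xs = xs"
      using xs_old by (intro map_idI) (simp add: rotate_tile_def)
    show "map (rotate_tile A B C D ?V2) ys = map (map_tile f) ys"
      using ys_new by (intro map_cong refl) (simp add: rotate_tile_def f_def)
  qed
  have AB_last: "{A, B} \<in> tile_edges (last xs)" and CD_last: "{C, D} \<in> tile_edges (last xs)"
    using edges last by auto
  have chain': "tile_chain (xs @ map (map_tile f) ys)"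
  proof (rule tile_chain_reglue(1)[where A = A and B = B and C = C and D = D])
    show "tile_cut (xs @ ys) (length xs - 1) \<noteq> {A, B}" if "1 < length xs"
      using that BC len dist by (auto simp: ts[symmetric] doubleton_eq_iff)
  qed (use chain ne CD AB_last notY inj fv in \<open>simp_all add: ts[symmetric] len\<close>)
  have verts: "tiles_verts (xs @ map (map_tile f) ys) = tiles_verts ?ts"
  proof -
    have "{A, B, C, D} \<subseteq> tiles_verts xs"
      using Q(1) set_tile_subset_tiles_verts[OF last_in_set[OF ne(1)]] last by simp
    moreover have "tiles_verts (xs @ map (map_tile f) ys) = tiles_verts xs \<union> (?V2 \<union> {A, B})"
      by (simp only: tiles_verts_append tiles_verts_map fY)
    moreover have "tiles_verts ?ts = tiles_verts xs \<union> (?V2 \<union> {C, D})"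
      unfolding Y[symmetric] by (simp only: ts tiles_verts_append)
    ultimately show ?thesis by auto
  qed
  define S R where "S = {v \<in> ?V2. {D, v} \<in> edges G}" and "R = {v \<in> ?V2. {C, v} \<in> edges G}"
  have Exy: "edges G = tiles_edges xs \<union> tiles_edges ys"
    unfolding Ge ts by (auto simp: tiles_edges_def)
  have xs_edge: "e \<inter> ?V2 = {}" if "e \<in> tiles_edges xs" for e
    using that xs_old tile_edges_subset unfolding tiles_edges_def by blast
  have ys_edge: "e \<subseteq> ?V2 \<or> (\<exists>v\<in>?V2. e = {C, v}) \<or> (\<exists>v\<in>?V2. e = {D, v}) \<or> e = {C, D}"
    if e: "e \<in> tiles_edges ys" for e
  proof -
    obtain t where t: "t \<in> set ys" "e \<in> tile_edges t"
      using e by (auto simp: tiles_edges_def)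
    then have "card e = 2"
      using tile_chainD(1)[OF chain, of t] by (auto simp: ts intro: card_tile_edge)
    then obtain u v where uv: "e = {u, v}" "u \<noteq> v"
      by (auto simp: card_2_iff)
    have "u \<in> ?V2 \<union> {C, D}" "v \<in> ?V2 \<union> {C, D}"
      using tile_edges_subset[OF t(2)] set_tile_subset_tiles_verts[OF t(1)] uv(1) Y by auto
    then show ?thesis
      using uv by (auto simp: insert_commute)
  qed
  have f_pair: "f ` {C, v} = {A, v}" "f ` {D, v} = {B, v}" if "v \<in> ?V2" for v
    using f_sub[of "{v}"] that fv(1,2) by auto
  have f_CD: "f ` {C, D} = {A, B}" using fv(1,2) by simp
  have last_in: "tile_edges (last xs) \<subseteq> tiles_edges xs"
    using last_in_set[OF ne(1)] unfolding tiles_edges_def by blast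
  have in_ys: "e \<in> tiles_edges ys" if "e \<in> edges G" "v \<in> e" "v \<in> ?V2" for e v
    using that xs_edge unfolding Exy by blast
  have map_edges: "tiles_edges (xs @ map (map_tile f) ys) = tiles_edges xs \<union> (`) f ` tiles_edges ys"
    by (auto simp: tiles_edges_def tile_edges_map_tile)
  \<comment> \<open>The edge \<open>CD\<close> is the delicate one. It is not deleted, since tile
    \<open>m\<close> keeps it, and its image \<open>AB\<close> under the relabelling is already an
    edge of tile \<open>m\<close>.\<close>
  have new_edges: "(edges G - ((\<lambda>v. {D, v}) ` S \<union> (\<lambda>v. {C, v}) ` R))
        \<union> ((\<lambda>v. {B, v}) ` S \<union> (\<lambda>v. {A, v}) ` R) = tiles_edges (xs @ map (map_tile f) ys)"
    (is "?L = _")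
    unfolding map_edges
  proof (intro equalityI subsetI)
    fix e assume "e \<in> ?L"
    then consider "e \<in> edges G" "e \<notin> (\<lambda>v. {D, v}) ` S" "e \<notin> (\<lambda>v. {C, v}) ` R"
      | v where "v \<in> S" "e = {B, v}" | v where "v \<in> R" "e = {A, v}"
      by blast
    then show "e \<in> tiles_edges xs \<union> (`) f ` tiles_edges ys"
    proof cases
      case 1
      show ?thesis
      proof (cases "e \<in> tiles_edges xs")
        case False
        then have e: "e \<in> tiles_edges ys" using 1(1) Exy by blast
        have "\<not> (\<exists>v\<in>?V2. e = {C, v})" "\<not> (\<exists>v\<in>?V2. e = {D, v})"
          using 1 by (auto simp: S_def R_def)
        moreover have "e \<noteq> {C, D}" using False CD_last last_in by blast
        ultimately have "f ` e = e" using ys_edge[OF e] f_sub by blast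
        then show ?thesis using e by (metis UnI2 image_eqI)
      qed simp
    next
      case 2
      then have "v \<in> ?V2" "{D, v} \<in> tiles_edges ys"
        using in_ys[of "{D, v}" v] by (auto simp: S_def)
      then show ?thesis using f_pair(2)[of v] 2(2) by (metis UnI2 image_eqI)
    next
      case 3
      then have "v \<in> ?V2" "{C, v} \<in> tiles_edges ys"
        using in_ys[of "{C, v}" v] by (auto simp: R_def)
      then show ?thesis using f_pair(1)[of v] 3(2) by (metis UnI2 image_eqI)
    qed
  next
    fix e assume "e \<in> tiles_edges xs \<union> (`) f ` tiles_edges ys"
    then consider "e \<in> tiles_edges xs" | d where "d \<in> tiles_edges ys" "e = f ` d"
      by blast
    then show "e \<in> ?L"
    proof cases
      case 1
      then have "e \<in> edges G" "e \<inter> ?V2 = {}" using Exy xs_edge by auto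
      then show ?thesis by (auto simp: S_def R_def)
    next
      case 2
      then have d: "d \<in> edges G" using Exy by blast
      from ys_edge[OF 2(1)] consider "d \<subseteq> ?V2" | v where "v \<in> ?V2" "d = {C, v}"
        | v where "v \<in> ?V2" "d = {D, v}" | "d = {C, D}" by blast
      then show ?thesis
      proof cases
        case 1
        then have "C \<notin> d" "D \<notin> d" using V2Q by auto
        then show ?thesis using f_sub[OF 1] d 2(2) by auto
      next
        case (2 v)
        then have "v \<in> R" using d by (simp add: R_def)
        moreover have "e = {A, v}" using f_pair(1)[OF 2(1)] 2(2) \<open>e = f ` d\<close> by simp
        ultimately show ?thesis by simp
      next
        case (3 v)
        then have "v \<in> S" using d by (simp add: S_def)
        moreover have "e = {B, v}" using f_pair(2)[OF 3(1)] 3(2) \<open>e = f ` d\<close> by simp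
        ultimately show ?thesis by simp
      next
        case 4
        then have e: "e = {A, B}" using 2(2) f_CD by simp
        then have "e \<in> tiles_edges xs" using AB_last last_in by blast
        then have "e \<in> edges G" "e \<inter> ?V2 = {}" using Exy xs_edge by auto
        then show ?thesis by (auto simp: S_def R_def)
      qed
    qed
  qed
  have "rotate G A B C D ?V2 = \<lparr>verts = tiles_verts (xs @ map (map_tile f) ys),
      edges = tiles_edges (xs @ map (map_tile f) ys), tiles = xs @ map (map_tile f) ys\<rparr>"
    unfolding rotate_def Let_def S_def[symmetric] R_def[symmetric] new_edges tiles
    by (simp only: verts Gv)
  then show ?thesis
    using chain' ne by (simp add: chain_graph_def)
qed

text \<open>No edge that avoids the square joins \<open>V2\<close> to its complement, so membership
  in \<open>V2\<close> is constant on the connected part beyond the tile. The cut consists of the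
  corners that have neighbours there: \<open>B\<close> and \<open>C\<close> on the \<open>V1\<close>
  side, \<open>C\<close> and \<open>D\<close> on the \<open>V2\<close> side.\<close>

lemma rotatable_beyond:
  assumes G: "chain_graph G" and m: "m < length (tiles G)"
    and Q: "set_tile (tiles G ! m) = {A, B, C, D}"
    and rot: "rotatable G A B C D V1 V2"
  shows "beyond (tiles G) m \<subseteq> V1 \<or> beyond (tiles G) m \<subseteq> V2"
    and "Suc m < length (tiles G) \<Longrightarrow> beyond (tiles G) m \<subseteq> V1 \<Longrightarrow> tile_cut (tiles G) (Suc m) = {B, C}"
    and "Suc m < length (tiles G) \<Longrightarrow> beyond (tiles G) m \<subseteq> V2 \<Longrightarrow> tile_cut (tiles G) (Suc m) = {C, D}"
proof -
  let ?ts = "tiles G" and ?Q = "{A, B, C, D}"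
  have chain: "tile_chain ?ts" and Gv: "verts G = tiles_verts ?ts" and Ge: "edges G = tiles_edges ?ts"
    using G by (auto simp: chain_graph_def)
  have V: "verts G = ?Q \<union> V1 \<union> V2" "?Q \<inter> V1 = {}" "?Q \<inter> V2 = {}" "V1 \<inter> V2 = {}"
    and r2: "\<forall>e\<in>edges G. e \<inter> V2 \<noteq> {} \<and> \<not> e \<subseteq> V2 \<longrightarrow> (\<exists>v\<in>V2. e = {D, v} \<or> e = {C, v})"
    and r1: "\<forall>e\<in>edges G. e \<inter> V1 \<noteq> {} \<and> \<not> e \<subseteq> V1 \<longrightarrow> (\<exists>v\<in>V1. e = {B, v} \<or> e = {C, v})"
    using rot unfolding rotatable_def by - (elim conjE, assumption)+
  note e1 = r1[rule_format, OF _ conjI] and e2 = r2[rule_format, OF _ conjI]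
  have e: "{u, v} \<in> edges G" if "t \<in> set ?ts" "{u, v} \<in> tile_edges t" for t u v
    using that by (auto simp: Ge tiles_edges_def)
  have sub: "beyond ?ts m \<subseteq> V1 \<union> V2"
  proof -
    have "beyond ?ts m \<subseteq> verts G - ?Q"
      using Q by (auto simp: beyond_def Gv tiles_verts_def dest: in_set_dropD)
    then show ?thesis using V(1) by blast
  qed
  have closed: "(u \<in> V2) = (v \<in> V2)"
    if "t \<in> set ?ts" "{u, v} \<in> tile_edges t" "u \<notin> set_tile (?ts ! m)" "v \<notin> set_tile (?ts ! m)" for t u v
  proof (rule ccontr)
    assume "(u \<in> V2) \<noteq> (v \<in> V2)"
    then have "{u, v} \<inter> V2 \<noteq> {}" "\<not> {u, v} \<subseteq> V2" by auto
    from e2[OF e[OF that(1,2)] this] obtain x where "{u, v} = {D, x} \<or> {u, v} = {C, x}"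
      by blast
    then show False using that(3,4) unfolding Q by (auto simp: doubleton_eq_iff)
  qed
  have unif: "(u \<in> V2) = (v \<in> V2)" if "u \<in> beyond ?ts m" "v \<in> beyond ?ts m" for u v
    by (rule tile_chain_beyond_uniform[where P = "\<lambda>v. v \<in> V2", OF chain _ that]) (rule closed)
  show "beyond ?ts m \<subseteq> V1 \<or> beyond ?ts m \<subseteq> V2"
  proof (cases "beyond ?ts m \<inter> V2 = {}")
    case True
    then show ?thesis using sub by blast
  next
    case False
    then obtain u where "u \<in> beyond ?ts m" "u \<in> V2" by blast
    then have "beyond ?ts m \<subseteq> V2" using unif by blast
    then show ?thesis ..
  qed
  have card: "card {a, b} \<le> 2" for a b :: 'a
    by (cases "a = b") auto
  show "tile_cut ?ts (Suc m) = {B, C}" if m': "Suc m < length ?ts" and W: "beyond ?ts m \<subseteq> V1"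
  proof (rule tile_chain_cut_eq[OF chain m' card])
    fix t u x assume *: "t \<in> set ?ts" "u \<in> set_tile (?ts ! m)" "x \<in> beyond ?ts m" "{u, x} \<in> tile_edges t"
    then have x: "x \<in> V1" "u \<notin> V1" using W V(2) unfolding Q by blast+
    then have "{u, x} \<inter> V1 \<noteq> {}" "\<not> {u, x} \<subseteq> V1" by auto
    from e1[OF e[OF *(1,4)] this] obtain v where "v \<in> V1" "{u, x} = {B, v} \<or> {u, x} = {C, v}"
      by blast
    then show "u \<in> {B, C}" using x by (auto simp: doubleton_eq_iff)
  qed simp
  show "tile_cut ?ts (Suc m) = {C, D}" if m': "Suc m < length ?ts" and W: "beyond ?ts m \<subseteq> V2"
  proof (rule tile_chain_cut_eq[OF chain m' card])
    fix t u x assume *: "t \<in> set ?ts" "u \<in> set_tile (?ts ! m)" "x \<in> beyond ?ts m" "{u, x} \<in> tile_edges t"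
    then have x: "x \<in> V2" "u \<notin> V2" using W V(3) unfolding Q by blast+
    then have "{u, x} \<inter> V2 \<noteq> {}" "\<not> {u, x} \<subseteq> V2" by auto
    from e2[OF e[OF *(1,4)] this] obtain v where "v \<in> V2" "{u, x} = {D, v} \<or> {u, x} = {C, v}"
      by blast
    then show "u \<in> {C, D}" using x by (auto simp: doubleton_eq_iff)
  qed simp
qed

lemma beyond_rev:
  assumes "m < length ts"
  shows "beyond (rev ts) (length ts - Suc m) = tiles_verts (take m ts) - set_tile (ts ! m)"
  using assms by (simp add: beyond_def drop_rev rev_nth)

lemma card_four_cycle:
  assumes "distinct [a, b, c, d]"
  shows "card {{a, b}, {b, c}, {c, d}, {d, a}} = 4"
proof -
  have "distinct [{a, b}, {b, c}, {c, d}, {d, a}]"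
    using assms by (auto simp: doubleton_eq_iff)
  from distinct_card[OF this] show ?thesis by simp
qed

text \<open>The set \<open>V2\<close> is empty, everything after the tile or everything before it.
  In the first case the rotation is the identity, and the last reduces to the second by reversing
  the list.\<close>

lemma chain_graph_rotate:
  assumes G: "chain_graph G" and t: "t \<in> set (tiles G)" "set_tile t = {A, B, C, D}"
    and rot: "rotatable G A B C D V1 V2"
  shows "chain_graph (rotate G A B C D V2)"
proof -
  let ?ts = "tiles G" and ?N = "length (tiles G)"
  obtain m where m: "m < ?N" "?ts ! m = t"
    using t(1) by (auto simp: in_set_conv_nth)
  have chain: "tile_chain ?ts" and Gv: "verts G = tiles_verts ?ts" and Ge: "edges G = tiles_edges ?ts"
    using G by (auto simp: chain_graph_def)
  have dist: "distinct [A, B, C, D]" and V: "verts G = {A, B, C, D} \<union> V1 \<union> V2"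
      "{A, B, C, D} \<inter> V1 = {}" "{A, B, C, D} \<inter> V2 = {}" "V1 \<inter> V2 = {}"
    and induced: "{e \<in> edges G. e \<subseteq> {A, B, C, D}} = {{A, B}, {B, C}, {C, D}, {D, A}}"
    using rot unfolding rotatable_def by - (elim conjE, assumption)+
  have Q: "set_tile (?ts ! m) = {A, B, C, D}" using m t by simp
  \<comment> \<open>The tile is given by its vertex set only. Its four edges are among the four
    edges induced on \<open>A\<close>, \<open>B\<close>, \<open>C\<close>, \<open>D\<close>, so they
    coincide with them.\<close>
  have edges: "tile_edges (?ts ! m) = {{A, B}, {B, C}, {C, D}, {D, A}}"
  proof (rule card_subset_eq)
    have "tile_edges t \<subseteq> {e \<in> edges G. e \<subseteq> {A, B, C, D}}"
      using t tile_edges_subset by (fastforce simp: Ge tiles_edges_def)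
    then show "tile_edges (?ts ! m) \<subseteq> {{A, B}, {B, C}, {C, D}, {D, A}}"
      using induced m by simp
    have "card (tile_edges t) = 4"
      unfolding tile_edges_def
      by (rule card_four_cycle[OF card_4_corners[OF tile_chainD(1)[OF chain t(1)]]])
    moreover have "card {{A, B}, {B, C}, {C, D}, {D, A}} = 4"
      using dist by (rule card_four_cycle)
    ultimately show "card (tile_edges (?ts ! m)) = card {{A, B}, {B, C}, {C, D}, {D, A}}"
      using m by simp
  qed simp
  \<comment> \<open>In the reversed list the tile has index \<open>?N - Suc m\<close>, so
    \<open>beyond\<close> there is the side before the tile.\<close>
  let ?G' = "G\<lparr>tiles := rev ?ts\<rparr>" and ?m' = "?N - Suc m"
  have G': "chain_graph ?G'" using G chain_graph_rev by blast
  have same: "verts ?G' = verts G" "edges ?G' = edges G" by simp_all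
  have rot': "rotatable ?G' A B C D V1 V2"
    using rot unfolding rotatable_def two_colouring_def same .
  have Q': "set_tile (tiles ?G' ! ?m') = {A, B, C, D}" "tile_edges (tiles ?G' ! ?m') = {{A, B}, {B, C}, {C, D}, {D, A}}"
    using Q edges m by (simp_all add: rev_nth)
  have m': "?m' < length (tiles ?G')" using m by simp
  let ?after = "beyond ?ts m" and ?before = "beyond (rev ?ts) ?m'"
  note after = rotatable_beyond[OF G m(1) Q rot]
    and before = rotatable_beyond[OF G' m' Q'(1) rot', simplified]
  have cut': "tile_cut (rev ?ts) (Suc ?m') = tile_cut ?ts m" if "0 < m"
    using m by (subst tile_cut_rev) auto
  have cut'': "tile_cut (rev ?ts) ?m' = tile_cut ?ts (Suc m)"
    using m by (subst tile_cut_rev) auto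
  have "verts G = tiles_verts (take m ?ts @ [?ts ! m] @ drop (Suc m) ?ts)"
    unfolding Gv using id_take_nth_drop[OF m(1)] by simp
  then have "verts G = tiles_verts (take m ?ts) \<union> ({A, B, C, D} \<union> tiles_verts (drop (Suc m) ?ts))"
    unfolding tiles_verts_append by (simp add: tiles_verts_def Q)
  moreover have "?before = tiles_verts (take m ?ts) - {A, B, C, D}"
    unfolding beyond_rev[OF m(1)] Q ..
  moreover have "?after = tiles_verts (drop (Suc m) ?ts) - {A, B, C, D}"
    unfolding beyond_def Q ..
  ultimately have "?before \<union> ?after = verts G - {A, B, C, D}"
    by (simp only: Un_Diff Diff_cancel Un_empty_left)
  moreover have "V1 \<union> V2 = verts G - {A, B, C, D}"
    unfolding V(1) using V(2,3) by auto
  ultimately have rest: "V1 \<union> V2 = ?before \<union> ?after" by simp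
  have no_after: "?after = {}" if "\<not> Suc m < ?N" 
    using that by (simp add: beyond_def tiles_verts_def)
  have no_before: "?before = {}" if "m = 0" 
    using that m by (simp add: beyond_rev tiles_verts_def)
  consider "V2 = {}" | "?after \<inter> V2 \<noteq> {}" | "?before \<inter> V2 \<noteq> {}"
    using rest by blast
  then show ?thesis
  proof cases
    case 1
    then show ?thesis using G rotate_empty by metis
  next
    case 2
    then have W: "?after \<subseteq> V2" using after(1) V(4) by blast
    have N: "Suc m < ?N" using 2 no_after by blast
    have CD: "tile_cut ?ts (Suc m) = {C, D}" using after(3)[OF N W] .
    have BC: "tile_cut ?ts m = {B, C} \<and> ?before \<subseteq> V1" if "0 < m"
    proof -
      have Nm: "Suc ?m' < ?N" using that m by simp
      \<comment> \<open>With both sides in \<open>V2\<close>, both cuts at the tile would be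
        \<open>{C, D}\<close>, although consecutive cuts differ.\<close>
      have "\<not> ?before \<subseteq> V2"
        using before(3)[OF Nm] cut'[OF that] CD tile_chainD(4)[OF chain that N] by auto
      then have "?before \<subseteq> V1" using before(1) by blast
      then show ?thesis using before(2)[OF Nm] cut'[OF that] by simp
    qed
    have "?before \<subseteq> V1" using BC no_before by (cases "m = 0") auto
    then have "V2 = ?after" using rest W V(4) by blast
    then show ?thesis
      using chain_graph_rotate_beyond[OF G N Q dist edges CD] BC by auto
  next
    case 3
    then have W: "?before \<subseteq> V2" using before(1) V(4) by blast
    have m0: "0 < m" using 3 no_before by blast
    have N: "Suc ?m' < ?N" using m m0 by simp
    have CD: "tile_cut (rev ?ts) (Suc ?m') = {C, D}" using before(3)[OF N W] .
    have BC: "tile_cut (rev ?ts) ?m' = {B, C} \<and> ?after \<subseteq> V1" if "Suc m < ?N"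
    proof -
      have "\<not> ?after \<subseteq> V2"
        using after(3)[OF that] CD cut'[OF m0] tile_chainD(4)[OF chain m0 that] by auto
      then have "?after \<subseteq> V1" using after(1) by blast
      then show ?thesis using after(2)[OF that] cut'' by simp
    qed
    have "?after \<subseteq> V1" using BC no_after by (cases "Suc m < ?N") auto
    then have V2: "V2 = ?before" using rest W V(4) by blast
    have "chain_graph (rotate ?G' A B C D (beyond (tiles ?G') ?m'))"
      by (rule chain_graph_rotate_beyond[OF G' _ Q'(1) dist Q'(2)]) (use N CD BC in auto)
    then show ?thesis
      using V2 by (simp add: rotate_rev chain_graph_rev)
  qed
qed

lemma generalised_snake_graph_chain_graph:
  "generalised_snake_graph G \<Longrightarrow> chain_graph G"
proof (induction rule: generalised_snake_graph.induct)
  case (snake G)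
  then obtain ps where ps: "ps \<noteq> []" "tiles G = map unit_tile ps"
      "verts G = (\<Union>t\<in>set (tiles G). set_tile t)" "edges G = (\<Union>t\<in>set (tiles G). tile_edges t)"
    and step: "\<And>i. Suc i < length ps \<Longrightarrow>
      ps ! Suc i = (fst (ps ! i) + 1, snd (ps ! i)) \<or> ps ! Suc i = (fst (ps ! i), snd (ps ! i) + 1)"
    unfolding snake_graph_def by blast
  show ?case
    using ps tile_chain_snake[OF step] by (simp add: chain_graph_def tiles_verts_def tiles_edges_def)
next
  case (rotation G t A B C D V1 V2)
  show ?case
    by (rule chain_graph_rotate[OF rotation.IH rotation.hyps(2,3,4)])
qed


section \<open>Generalised snake graphs are strips\<close>

text \<open>The edge along which tile \<open>k\<close> is glued to its predecessor, extended by the start edge for \<open>k = 0\<close>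
  and by the end edge for \<open>k = length ts\<close>.\<close>

definition crossing :: "'a tile list \<Rightarrow> nat \<Rightarrow> 'a set" where
  "crossing ts k =
     (if k = 0 then set_tile (ts ! 0) - tile_cut ts 1
      else if k = length ts then set_tile (ts ! (k - 1)) - tile_cut ts (k - 1)
      else tile_cut ts k)"

lemma tile_edge_cycle:
  assumes "card (set_tile t) = 4" "{b, c} \<in> tile_edges t"
  obtains x y where "set_tile t = {b, c, x, y}" "distinct [b, c, x, y]"
    "tile_edges t = {{b, c}, {c, x}, {x, y}, {y, b}}"
proof -
  note D = card_4_corners[OF assms(1)] and E = tile_edges_def[of t] and C = set_tile_corners[of t]
  have "\<exists>x y. set_tile t = {b, c, x, y} \<and> distinct [b, c, x, y] \<and>
      tile_edges t = {{b, c}, {c, x}, {x, y}, {y, b}}"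
    if "set_tile t = {p, q, r, s}" "distinct [p, q, r, s]"
      "tile_edges t = {{p, q}, {q, r}, {r, s}, {s, p}}" "{b, c} = {p, q}" for p q r s
  proof (cases "b = p")
    case True
    then have "c = q" using that(4) by (auto simp: doubleton_eq_iff)
    show ?thesis
      by (rule exI[of _ r], rule exI[of _ s]) (use that(1-3) True \<open>c = q\<close> in simp)
  next
    case False
    then have bc: "b = q" "c = p" using that(4) by (auto simp: doubleton_eq_iff)
    show ?thesis
      by (rule exI[of _ s], rule exI[of _ r]) (use that(1-3) bc in \<open>auto simp: insert_commute\<close>)
  qed
  note main = this
  from assms(2) consider "{b, c} = {sw t, se t}" | "{b, c} = {se t, ne t}"
    | "{b, c} = {ne t, nw t}" | "{b, c} = {nw t, sw t}"
    unfolding E by blast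
  then have "\<exists>x y. set_tile t = {b, c, x, y} \<and> distinct [b, c, x, y] \<and>
      tile_edges t = {{b, c}, {c, x}, {x, y}, {y, b}}"
  proof cases
    case 1
    show ?thesis by (rule main[OF C D E 1])
  next
    case 2
    show ?thesis by (rule main[of "se t" "ne t" "nw t" "sw t", OF _ _ _ 2]) (use D in \<open>auto simp: E C\<close>)
  next
    case 3
    show ?thesis by (rule main[of "ne t" "nw t" "sw t" "se t", OF _ _ _ 3]) (use D in \<open>auto simp: E C\<close>)
  next
    case 4
    show ?thesis by (rule main[of "nw t" "sw t" "se t" "ne t", OF _ _ _ 4]) (use D in \<open>auto simp: E C\<close>)
  qed
  then show ?thesis using that by blast
qed

lemma tile_opposite_edge:
  assumes "card (set_tile t) = 4" "e \<in> tile_edges t"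
  shows "set_tile t - e \<in> tile_edges t"
proof -
  obtain b c where e: "e = {b, c}" using assms(2) by (auto simp: tile_edges_def)
  obtain x y where xy: "set_tile t = {b, c, x, y}" "distinct [b, c, x, y]"
    "tile_edges t = {{b, c}, {c, x}, {x, y}, {y, b}}"
    using tile_edge_cycle[OF assms(1) assms(2)[unfolded e]] .
  have "set_tile t - e = {x, y}" unfolding e xy(1) using xy(2) by auto
  then show ?thesis using xy(3) by simp
qed

context
  fixes ts :: "'a tile list"
  assumes chain: "tile_chain ts" and two: "2 \<le> length ts"
begin

lemma length_pos: "0 < length ts" "ts \<noteq> []" "length ts - Suc 0 < length ts"
proof -
  show "0 < length ts" using two by linarith
  then show "ts \<noteq> []" "length ts - Suc 0 < length ts" by simp_all
qed

lemma crossing_edges: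
  assumes "k < length ts"
  shows "crossing ts k \<in> tile_edges (ts ! k)" "crossing ts (Suc k) \<in> tile_edges (ts ! k)"
    "crossing ts k \<noteq> crossing ts (Suc k)"
proof -
  have t: "card (set_tile (ts ! i)) = 4" if "i < length ts" for i
    using tile_chainD(1)[OF chain] that by simp
  have cuts: "tile_cut ts (Suc i) \<in> tile_edges (ts ! i)" "tile_cut ts (Suc i) \<in> tile_edges (ts ! Suc i)"
    if "Suc i < length ts" for i
    using tile_chainD(2,3)[OF chain, of "Suc i"] that by auto
  have opp: "set_tile t - e \<noteq> e" if "e \<in> tile_edges t" for t :: "'a tile" and e
    using that by (auto simp: tile_edges_def)
  consider "k = 0" | "0 < k" "Suc k < length ts" | "0 < k" "Suc k = length ts"
    using assms by linarith
  then have "crossing ts k \<in> tile_edges (ts ! k) \<and> crossing ts (Suc k) \<in> tile_edges (ts ! k) \<and>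
    crossing ts k \<noteq> crossing ts (Suc k)"
  proof cases
    case 1
    then show ?thesis
      using two length_pos cuts[of 0] tile_opposite_edge[OF t[of 0] cuts(1)[of 0]] opp[OF cuts(1)[of 0]]
      by (auto simp: crossing_def)
  next
    case 2
    then show ?thesis
      using cuts[of "k - 1"] cuts[of k] tile_chainD(4)[OF chain, of k] by (auto simp: crossing_def)
  next
    case 3
    then have "tile_cut ts k \<in> tile_edges (ts ! k)" using cuts(2)[of "k - 1"] by simp
    moreover have "crossing ts k = tile_cut ts k"
      using 3 by (simp add: crossing_def)
    moreover have "crossing ts (Suc k) = set_tile (ts ! k) - tile_cut ts k"
      by (simp add: crossing_def 3(2)[symmetric])
    ultimately show ?thesis
      using tile_opposite_edge[OF t[OF assms]] opp by metis
  qed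
  then show "crossing ts k \<in> tile_edges (ts ! k)" "crossing ts (Suc k) \<in> tile_edges (ts ! k)"
    "crossing ts k \<noteq> crossing ts (Suc k)" by simp_all
qed

lemma common_vertex_in_cut:
  assumes "i < j" "j < length ts" "v \<in> set_tile (ts ! i)" "v \<in> set_tile (ts ! j)"
  shows "v \<in> tile_cut ts (Suc i)" "v \<in> tile_cut ts j"
  using in_tile_cutI[of i "Suc i" j ts v] in_tile_cutI[of i j j ts v] assms by auto

lemma cut_subset_tiles:
  assumes "0 < k" "k < length ts"
  shows "tile_cut ts k \<subseteq> set_tile (ts ! (k - 1))" "tile_cut ts k \<subseteq> set_tile (ts ! k)"
  using tile_chainD(2,3)[OF chain assms] by (auto dest: tile_edges_subset)

text \<open>This is the freshness needed for gluing tile \<open>k\<close>. Adding the start edge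
  makes it uniform: it plays the role of the previous cut for the first tile.\<close>

lemma tile_inter_previous:
  assumes "k < length ts"
  shows "set_tile (ts ! k) \<inter> (crossing ts 0 \<union> tiles_verts (take k ts)) = crossing ts k"
proof (cases "k = 0")
  case True
  then show ?thesis by (auto simp: tiles_verts_def crossing_def)
next
  case False
  have "ts ! 0 \<in> set (take k ts)"
    using False assms by (cases ts; cases k) auto
  then have "crossing ts 0 \<subseteq> tiles_verts (take k ts)"
    using set_tile_subset_tiles_verts[of "ts ! 0" "take k ts"] by (auto simp: crossing_def)
  then have "crossing ts 0 \<union> tiles_verts (take k ts) = tiles_verts (take k ts)" by blast
  moreover have "set_tile (ts ! k) \<inter> tiles_verts (take k ts) = tile_cut ts k"
  proof
    have "ts ! k \<in> set (drop k ts)"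
      using assms by (auto simp: in_set_conv_nth intro!: exI[of _ 0])
    then show "set_tile (ts ! k) \<inter> tiles_verts (take k ts) \<subseteq> tile_cut ts k"
      using set_tile_subset_tiles_verts[of "ts ! k" "drop k ts"] by (auto simp: tile_cut_def)
    show "tile_cut ts k \<subseteq> set_tile (ts ! k) \<inter> tiles_verts (take k ts)"
      using cut_subset_tiles(2)[of k] False assms by (auto simp: tile_cut_def)
  qed
  ultimately show ?thesis using False assms by (simp add: crossing_def)
qed

text \<open>Start and end edge are disjoint from the cut in their tile, so a vertex on both
  crossings of a tile occurs only at an inner tile, and then its two neighbours contain it as
  well.\<close>

lemma three_tiles_at_pivot:
  assumes "k < length ts" "v \<in> crossing ts k" "v \<in> crossing ts (Suc k)"
  shows "0 < k" "Suc k < length ts"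
    and "v \<in> set_tile (ts ! (k - 1))" "v \<in> set_tile (ts ! k)" "v \<in> set_tile (ts ! Suc k)"
proof -
  have "k \<noteq> 0" using assms two by (auto simp: crossing_def split: if_splits)
  then show k: "0 < k" by simp
  have "Suc k \<noteq> length ts"
  proof
    assume N: "Suc k = length ts"
    then have "v \<in> crossing ts (length ts)" "k = length ts - 1"
      using assms(3) by simp_all
    moreover have "v \<in> tile_cut ts k"
      using assms(1,2) k by (simp add: crossing_def)
    ultimately show False
      using length_pos by (simp add: crossing_def)
  qed
  then show k': "Suc k < length ts" using assms(1) by simp
  have "v \<in> tile_cut ts k" "v \<in> tile_cut ts (Suc k)"
    using assms k k' by (auto simp: crossing_def)
  then show "v \<in> set_tile (ts ! (k - 1))" "v \<in> set_tile (ts ! k)" "v \<in> set_tile (ts ! Suc k)"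
    using cut_subset_tiles[of k] cut_subset_tiles[of "Suc k"] k k' by auto
qed

lemma private_tile_vertices:
  "{v \<in> set_tile (ts ! 0). \<forall>i<length ts. i \<noteq> 0 \<longrightarrow> v \<notin> set_tile (ts ! i)} = crossing ts 0"
  "{v \<in> set_tile (ts ! (length ts - 1)). \<forall>i<length ts. i \<noteq> length ts - 1 \<longrightarrow> v \<notin> set_tile (ts ! i)}
     = crossing ts (length ts)"
proof -
  let ?N = "length ts"
  have first: "(\<forall>i<?N. i \<noteq> 0 \<longrightarrow> v \<notin> set_tile (ts ! i)) \<longleftrightarrow> v \<notin> tile_cut ts 1"
    if "v \<in> set_tile (ts ! 0)" for v
    using common_vertex_in_cut(1)[of 0 _ v] cut_subset_tiles(2)[of 1] that two by fastforce
  show "{v \<in> set_tile (ts ! 0). \<forall>i<?N. i \<noteq> 0 \<longrightarrow> v \<notin> set_tile (ts ! i)} = crossing ts 0"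
    using first by (auto simp: crossing_def)
  have last: "(\<forall>i<?N. i \<noteq> ?N - 1 \<longrightarrow> v \<notin> set_tile (ts ! i)) \<longleftrightarrow> v \<notin> tile_cut ts (?N - 1)"
    if "v \<in> set_tile (ts ! (?N - 1))" for v
  proof
    assume "\<forall>i<?N. i \<noteq> ?N - 1 \<longrightarrow> v \<notin> set_tile (ts ! i)"
    then have "v \<notin> set_tile (ts ! (?N - 1 - 1))" using two by simp
    then show "v \<notin> tile_cut ts (?N - 1)"
      using cut_subset_tiles(1)[of "?N - 1"] two length_pos by auto
  next
    assume v: "v \<notin> tile_cut ts (?N - 1)"
    show "\<forall>i<?N. i \<noteq> ?N - 1 \<longrightarrow> v \<notin> set_tile (ts ! i)"
    proof (intro allI impI notI)
      fix i assume "i < ?N" "i \<noteq> ?N - 1" "v \<in> set_tile (ts ! i)"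
      then show False
        using common_vertex_in_cut(2)[of i "?N - 1" v] that v by simp
    qed
  qed
  show "{v \<in> set_tile (ts ! (?N - 1)). \<forall>i<?N. i \<noteq> ?N - 1 \<longrightarrow> v \<notin> set_tile (ts ! i)} = crossing ts ?N"
    using last two by (auto simp: crossing_def)
qed

lemma tile_edge_in_two_tiles:
  assumes "i < j" "j < length ts" "e \<in> tile_edges (ts ! i)" "e \<in> tile_edges (ts ! j)"
  shows "e = crossing ts (Suc i)" "e = crossing ts j"
proof -
  have t: "card (set_tile (ts ! l)) = 4" if "l < length ts" for l
    using tile_chainD(1)[OF chain] that by simp
  have eq: "e = d" if "e \<subseteq> d" "d \<in> tile_edges (ts ! l)" "l < length ts" for d l
  proof (rule card_subset_eq)
    have "card d = 2" using card_tile_edge[OF t[OF that(3)] that(2)] .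
    then show "finite d" by (intro card_ge_0_finite) simp
    show "card e = card d"
      using \<open>card d = 2\<close> card_tile_edge[OF t[of j] assms(4)] assms(2) by simp
  qed (rule that(1))
  have "e \<subseteq> set_tile (ts ! i)" "e \<subseteq> set_tile (ts ! j)"
    using assms(3,4) by (auto dest: tile_edges_subset)
  then have sub: "e \<subseteq> tile_cut ts (Suc i)" "e \<subseteq> tile_cut ts j"
    using common_vertex_in_cut[OF assms(1,2)] by auto
  have c: "crossing ts (Suc i) = tile_cut ts (Suc i)" "crossing ts j = tile_cut ts j"
    using assms(1,2) by (auto simp: crossing_def)
  show "e = crossing ts (Suc i)" "e = crossing ts j"
    using eq[OF sub(1), of i] eq[OF sub(2), of j] crossing_edges[of i] crossing_edges[of j]
      assms(1,2) c by auto
qed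

text \<open>An edge lies in two tiles only if it is a crossing strictly inside the chain. The start
  and end edges are crossings too, but lie in one tile each.\<close>

lemma edges_in_unique_tile:
  "{e \<in> tiles_edges ts. \<exists>!i. i < length ts \<and> e \<in> tile_edges (ts ! i)} =
     (\<Union>i<length ts. tile_edges (ts ! i) - {crossing ts i, crossing ts (Suc i)}) \<union>
     {crossing ts 0, crossing ts (length ts)}"
    (is "?outer = ?F \<union> ?ends")
  and inner_boundary_not_ends: "(\<Union>i<length ts. tile_edges (ts ! i) - {crossing ts i, crossing ts (Suc i)}) \<inter>
     {crossing ts 0, crossing ts (length ts)} = {}"
proof -
  let ?N = "length ts"
  have uniq: "i = j"
    if "i < ?N" "j < ?N" "e \<in> tile_edges (ts ! i)" "e \<in> tile_edges (ts ! j)"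
      "e \<noteq> crossing ts i \<or> i = 0" "e \<noteq> crossing ts (Suc i) \<or> Suc i = ?N" for i j e
  proof (cases i j rule: linorder_cases)
    case less
    then show ?thesis using tile_edge_in_two_tiles(1)[OF less] that by auto
  next
    case greater
    then show ?thesis using tile_edge_in_two_tiles(2)[OF greater] that by auto
  qed
  have last: "?N - 1 < ?N" "Suc (?N - 1) = ?N" using two by auto
  have in_outer: "e \<in> ?outer"
    if "i < ?N" "e \<in> tile_edges (ts ! i)" "e \<noteq> crossing ts i \<or> i = 0" "e \<noteq> crossing ts (Suc i) \<or> Suc i = ?N" for e i
  proof -
    have "\<exists>!j. j < ?N \<and> e \<in> tile_edges (ts ! j)"
    proof (rule ex1I[of _ i])
      show "j = i" if "j < ?N \<and> e \<in> tile_edges (ts ! j)" for j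
        using uniq[of i j e] that \<open>i < ?N\<close> \<open>e \<in> tile_edges (ts ! i)\<close>
          \<open>e \<noteq> crossing ts i \<or> i = 0\<close> \<open>e \<noteq> crossing ts (Suc i) \<or> Suc i = ?N\<close> by auto
    qed (use that in simp)
    moreover have "e \<in> tiles_edges ts"
      using that(1,2) by (auto simp: tiles_edges_def)
    ultimately show ?thesis by simp
  qed
  have start: "crossing ts 0 \<in> ?outer"
    using in_outer[of 0 "crossing ts 0"] crossing_edges[of 0] length_pos by auto
  have "end": "crossing ts ?N \<in> ?outer"
    using in_outer[OF last(1), of "crossing ts ?N"] crossing_edges(2,3)[OF last(1)] last(2) by metis
  show "?outer = ?F \<union> ?ends"
  proof (intro equalityI subsetI)
    fix e assume e: "e \<in> ?outer"
    then obtain i where i: "i < ?N" "e \<in> tile_edges (ts ! i)" "\<And>j. j < ?N \<Longrightarrow> e \<in> tile_edges (ts ! j) \<Longrightarrow> j = i"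
      by (elim CollectE conjE ex1E) blast
    have first: "e \<noteq> crossing ts i" if "i \<noteq> 0"
    proof -
      have "i - 1 < ?N" "i - 1 \<noteq> i" "Suc (i - 1) = i" using i(1) that by auto
      then show ?thesis using i(3)[of "i - 1"] crossing_edges(2)[of "i - 1"] by metis
    qed
    have final: "e \<noteq> crossing ts (Suc i)" if "Suc i \<noteq> ?N"
    proof -
      have "Suc i < ?N" using i(1) that by auto
      then show ?thesis using i(3)[of "Suc i"] crossing_edges(1)[of "Suc i"] by auto
    qed
    consider "e = crossing ts i" | "e = crossing ts (Suc i)" | "e \<notin> {crossing ts i, crossing ts (Suc i)}"
      by blast
    then show "e \<in> ?F \<union> ?ends"
    proof cases
      case 1
      then have "i = 0" using first by blast
      then show ?thesis using 1 by simp
    next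
      case 2
      then have "Suc i = ?N" using final by blast
      then show ?thesis using 2 by simp
    next
      case 3
      then show ?thesis using i(1,2) by blast
    qed
  next
    fix e assume "e \<in> ?F \<union> ?ends"
    then consider i where "i < ?N" "e \<in> tile_edges (ts ! i)" "e \<noteq> crossing ts i" "e \<noteq> crossing ts (Suc i)"
      | "e = crossing ts 0" | "e = crossing ts ?N" by blast
    then show "e \<in> ?outer"
      using start "end" in_outer by cases blast+
  qed
  show "?F \<inter> ?ends = {}"
  proof (rule equals0I)
    fix e assume "e \<in> ?F \<inter> ?ends"
    then obtain i where i: "i < ?N" "e \<in> tile_edges (ts ! i)" "e \<noteq> crossing ts i" "e \<noteq> crossing ts (Suc i)"
      and e: "e = crossing ts 0 \<or> e = crossing ts ?N" by blast
    from e show False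
    proof
      assume "e = crossing ts 0"
      then have "i = 0"
        using uniq[of i 0 e] i crossing_edges(1)[of 0] length_pos by auto
      then show False using i(3) \<open>e = crossing ts 0\<close> by simp
    next
      assume "e = crossing ts ?N"
      then have "i = ?N - 1"
        using uniq[of i "?N - 1" e] i crossing_edges(2)[of "?N - 1"] last by auto
      then show False using i(4) \<open>e = crossing ts ?N\<close> last by simp
    qed
  qed
qed

end

text \<open>Let the tile be the cycle \<open>b, c, x, y\<close>. Colours alternate, so
  \<open>x\<close> is black and \<open>y\<close> white. The hypothesis \<open>c \<notin> e\<close>
  excludes the edge \<open>cx\<close> and leaves \<open>xy\<close> (straight) or \<open>yb\<close>
  (pivot).\<close>

lemma strip_glue_tile:
  assumes s: "strip Bk U L b c n E F" and t: "card (set_tile t) = 4" "{b, c} \<in> tile_edges t"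
    and new: "set_tile t \<inter> (U \<union> L) = {b, c}"
    and e: "e \<in> tile_edges t" "e \<noteq> {b, c}" "c \<notin> e"
    and bip: "\<And>x y. {x, y} \<in> tile_edges t \<Longrightarrow> x \<in> Bk \<longleftrightarrow> y \<notin> Bk"
  obtains U' L' b' c' n' where
    "strip Bk U' L' b' c' n' (E \<union> tile_edges t) (F \<union> (tile_edges t - {{b, c}, e}))"
    "{b', c'} = e" "U' \<union> L' = U \<union> L \<union> set_tile t"
proof -
  obtain x y where xy: "set_tile t = {b, c, x, y}" "distinct [b, c, x, y]"
    "tile_edges t = {{b, c}, {c, x}, {x, y}, {y, b}}"
    using tile_edge_cycle[OF t] .
  note ends = strip_ends[OF s]
  have col: "x \<in> Bk" "y \<notin> Bk"
    using bip[of c x] bip[of x y] ends xy(3) by auto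
  have fresh: "x \<notin> U \<union> L" "y \<notin> U \<union> L"
    using new xy(1,2) by auto
  have E: "E \<union> tile_edges t = E \<union> {{b, y}, {x, y}, {x, c}}"
    using ends unfolding xy(3) by (auto simp: insert_commute)
  have ne: "b \<noteq> c" "b \<noteq> x" "b \<noteq> y" "c \<noteq> x" "c \<noteq> y" "x \<noteq> y" using xy(2) by auto
  from e xy(3) consider "e = {x, y}" | "e = {y, b}" by auto
  then show ?thesis
  proof cases
    case 1
    have F: "tile_edges t - {{b, c}, e} = {{b, y}, {x, c}}"
      unfolding xy(3) 1 using ne by (auto simp: doubleton_eq_iff)
    have "strip Bk (insert x L) (insert y U) x y b (E \<union> tile_edges t) (F \<union> (tile_edges t - {{b, c}, e}))"
      unfolding E F using strip.straight[OF s col fresh] .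
    moreover have "insert x L \<union> insert y U = U \<union> L \<union> set_tile t"
      unfolding xy(1) using ends by auto
    ultimately show ?thesis using that 1 by blast
  next
    case 2
    have F: "tile_edges t - {{b, c}, e} = {{x, y}, {x, c}}"
      unfolding xy(3) 2 using ne by (auto simp: doubleton_eq_iff)
    have "strip Bk U (insert x (insert y L)) b y x (E \<union> tile_edges t) (F \<union> (tile_edges t - {{b, c}, e}))"
      unfolding E F using strip.pivot[OF s col fresh] .
    moreover have "U \<union> insert x (insert y L) = U \<union> L \<union> set_tile t"
      unfolding xy(1) using ends by auto
    moreover have "{b, y} = e" using 2 by auto
    ultimately show ?thesis using that by blast
  qed
qed

text \<open>The strip begins as the bare start edge, before any tile is present; hence the
  \<open>insert\<close>, which is absorbed as soon as the first tile is glued.\<close>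

lemma tile_chain_strip:
  assumes chain: "tile_chain ts" and two: "2 \<le> length ts"
    and bip: "\<And>x y. {x, y} \<in> tiles_edges ts \<Longrightarrow> x \<in> Bk \<longleftrightarrow> y \<notin> Bk"
    and pivot: "\<And>k v. k < length ts \<Longrightarrow> v \<in> crossing ts k \<Longrightarrow> v \<in> crossing ts (Suc k) \<Longrightarrow> v \<in> Bk"
    and k: "k \<le> length ts"
  shows "\<exists>U L b c n. strip Bk U L b c n (insert (crossing ts 0) (tiles_edges (take k ts)))
      (\<Union>i<k. tile_edges (ts ! i) - {crossing ts i, crossing ts (Suc i)}) \<and>
    {b, c} = crossing ts k \<and> U \<union> L = crossing ts 0 \<union> tiles_verts (take k ts)"
  using k
proof (induction k)
  case 0
  note N = length_pos(1)[OF chain two]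
  have e: "crossing ts 0 \<in> tile_edges (ts ! 0)"
    using crossing_edges(1)[OF chain two N] .
  then obtain x y where xy: "crossing ts 0 = {x, y}"
    by (auto simp: tile_edges_def)
  have "{x, y} \<in> tiles_edges ts"
    using e N unfolding xy by (auto simp: tiles_edges_def)
  then have "x \<in> Bk \<longleftrightarrow> y \<notin> Bk" by (rule bip)
  then obtain b c where bc: "crossing ts 0 = {b, c}" "b \<in> Bk" "c \<notin> Bk"
    using xy by (cases "x \<in> Bk") (auto simp: insert_commute)
  have "strip Bk {b} {c} b c b (insert (crossing ts 0) (tiles_edges (take 0 ts)))
      (\<Union>i<0. tile_edges (ts ! i) - {crossing ts i, crossing ts (Suc i)})"
    using strip.edge[OF bc(2,3)] by (simp add: bc(1) tiles_edges_def)
  moreover have "{b} \<union> {c} = crossing ts 0 \<union> tiles_verts (take 0 ts)"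
    unfolding bc(1) by (auto simp: tiles_verts_def)
  ultimately show ?case using bc(1) by blast
next
  case (Suc k)
  then have kN: "k < length ts" by simp
  obtain U L b c n where s: "strip Bk U L b c n (insert (crossing ts 0) (tiles_edges (take k ts)))
      (\<Union>i<k. tile_edges (ts ! i) - {crossing ts i, crossing ts (Suc i)})"
    and bc: "{b, c} = crossing ts k" and V: "U \<union> L = crossing ts 0 \<union> tiles_verts (take k ts)"
    using Suc by auto
  note cr = crossing_edges[OF chain two kN]
  have t4: "card (set_tile (ts ! k)) = 4" using tile_chainD(1)[OF chain] kN by simp
  have e0: "{b, c} \<in> tile_edges (ts ! k)" using cr(1) bc by simp
  have new: "set_tile (ts ! k) \<inter> (U \<union> L) = {b, c}"
    unfolding V bc by (rule tile_inter_previous[OF chain two kN])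
  have ne: "crossing ts (Suc k) \<noteq> {b, c}" using cr(3) bc by simp
  \<comment> \<open>Here the colour of the turns enters: a vertex on both crossings of a tile is
    black, and \<open>c\<close> is white.\<close>
  have c: "c \<notin> crossing ts (Suc k)"
    using pivot[OF kN, of c] bc strip_ends[OF s] by auto
  have bip': "x \<in> Bk \<longleftrightarrow> y \<notin> Bk" if "{x, y} \<in> tile_edges (ts ! k)" for x y
  proof (rule bip)
    show "{x, y} \<in> tiles_edges ts" using that kN by (auto simp: tiles_edges_def)
  qed
  obtain U' L' b' c' n' where
    s': "strip Bk U' L' b' c' n' (insert (crossing ts 0) (tiles_edges (take k ts)) \<union> tile_edges (ts ! k))
      ((\<Union>i<k. tile_edges (ts ! i) - {crossing ts i, crossing ts (Suc i)}) \<union>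
        (tile_edges (ts ! k) - {{b, c}, crossing ts (Suc k)}))"
    and bc': "{b', c'} = crossing ts (Suc k)" and V': "U' \<union> L' = U \<union> L \<union> set_tile (ts ! k)"
    by (rule strip_glue_tile[OF s t4 e0 new cr(2) ne c bip'])
  have E: "insert (crossing ts 0) (tiles_edges (take k ts)) \<union> tile_edges (ts ! k) =
      insert (crossing ts 0) (tiles_edges (take (Suc k) ts))"
    using kN by (auto simp: take_Suc_conv_app_nth tiles_edges_def)
  have F: "(\<Union>i<k. tile_edges (ts ! i) - {crossing ts i, crossing ts (Suc i)}) \<union>
        (tile_edges (ts ! k) - {{b, c}, crossing ts (Suc k)}) =
      (\<Union>i<Suc k. tile_edges (ts ! i) - {crossing ts i, crossing ts (Suc i)})"
    unfolding bc lessThan_Suc by blast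
  have "U' \<union> L' = crossing ts 0 \<union> tiles_verts (take (Suc k) ts)"
    unfolding V' V using kN by (auto simp: take_Suc_conv_app_nth tiles_verts_def)
  then show ?case
    using s'[unfolded E F] bc' by blast
qed


section \<open>The two boundary paths\<close>

definition connected_by :: "'a set set \<Rightarrow> 'a set \<Rightarrow> bool" where
  "connected_by F S \<longleftrightarrow> (\<forall>x\<in>S. \<forall>y\<in>S. (x, y) \<in> {(x, y). {x, y} \<in> F}\<^sup>*)"

lemma connected_by_insert:
  assumes S: "connected_by F S" and a: "a \<in> S" and F: "F \<subseteq> F'" "{a, x} \<in> F'"
  shows "connected_by F' (insert x S)"
proof -
  let ?R = "{(x, y). {x, y} \<in> F'}\<^sup>*"
  have "{(x, y). {x, y} \<in> F}\<^sup>* \<subseteq> ?R"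
    using F(1) by (intro rtrancl_mono) auto
  then have old: "(y, z) \<in> ?R" if "y \<in> S" "z \<in> S" for y z
    using S that unfolding connected_by_def by blast
  have "(a, x) \<in> ?R" "(x, a) \<in> ?R"
    using F(2) by (auto simp: insert_commute intro!: r_into_rtrancl)
  then have "(y, a) \<in> ?R" "(a, y) \<in> ?R" if "y \<in> insert x S" for y
    using that old[OF _ a] old[OF a] by auto
  then show ?thesis
    unfolding connected_by_def by (blast intro: rtrancl_trans)
qed

lemma connected_by_mono:
  assumes "connected_by F S" "F \<subseteq> F'"
  shows "connected_by F' S"
proof -
  have "{(x, y). {x, y} \<in> F}\<^sup>* \<subseteq> {(x, y). {x, y} \<in> F'}\<^sup>*"
    using assms(2) by (intro rtrancl_mono) auto
  then show ?thesis using assms(1) unfolding connected_by_def by blast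
qed

text \<open>A new path edge extends the path of \<open>b\<close> or of \<open>c\<close> at its
  current end. The ends \<open>b\<close> and \<open>c\<close> are listed apart because no edge of
  \<open>F\<close> need reach them yet, as in a strip that is a single edge.\<close>

lemma strip_boundary:
  "strip Bk U L b c n E F \<Longrightarrow>
     connected_by F U \<and> connected_by F L \<and> (\<forall>e\<in>F. e \<subseteq> U \<or> e \<subseteq> L) \<and> U \<union> L \<subseteq> \<Union>F \<union> {b, c}"
proof (induction rule: strip.induct)
  case (edge b c)
  then show ?case by (simp add: connected_by_def)
next
  case (straight U L b c n E F b' c')
  note ends = strip_ends[OF straight.hyps(1)]
  have "connected_by (F \<union> {{b, c'}, {b', c}}) (insert b' L)"
    using straight.IH ends by (intro connected_by_insert[of F L c]) (auto simp: insert_commute)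
  moreover have "connected_by (F \<union> {{b, c'}, {b', c}}) (insert c' U)"
    using straight.IH ends by (intro connected_by_insert[of F U b]) auto
  moreover have "\<forall>e\<in>F \<union> {{b, c'}, {b', c}}. e \<subseteq> insert b' L \<or> e \<subseteq> insert c' U"
    using straight.IH ends by auto
  moreover have "insert b' L \<union> insert c' U \<subseteq> \<Union>(F \<union> {{b, c'}, {b', c}}) \<union> {b', c'}"
    using straight.IH by auto
  ultimately show ?case by blast
next
  case (pivot U L b c n E F b' c')
  note ends = strip_ends[OF pivot.hyps(1)]
  let ?F = "F \<union> {{b', c'}, {b', c}}"
  have "connected_by (F \<union> {{b', c}}) (insert b' L)"
    using pivot.IH ends by (intro connected_by_insert[of F L c]) (auto simp: insert_commute)
  then have "connected_by ?F (insert c' (insert b' L))"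
    by (rule connected_by_insert[of _ _ b']) auto
  moreover have "connected_by ?F U"
    using pivot.IH by (auto intro: connected_by_mono)
  moreover have "\<forall>e\<in>?F. e \<subseteq> U \<or> e \<subseteq> insert b' (insert c' L)"
    using pivot.IH ends by auto
  moreover have "U \<union> insert b' (insert c' L) \<subseteq> \<Union>?F \<union> {b, c'}"
    using pivot.IH by auto
  ultimately show ?case by (simp only: insert_commute[of c' b' L] simp_thms)
qed

lemma connected_by_component:
  assumes "connected_by F U" "\<forall>e\<in>F. e \<subseteq> U \<or> e \<subseteq> L" "U \<inter> L = {}" "u \<in> U"
  shows "{v. (u, v) \<in> {(x, y). {x, y} \<in> F}\<^sup>*} = U"
proof
  show "U \<subseteq> {v. (u, v) \<in> {(x, y). {x, y} \<in> F}\<^sup>*}"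
    using assms(1,4) unfolding connected_by_def by blast
  have "v \<in> U" if "(u, v) \<in> {(x, y). {x, y} \<in> F}\<^sup>*" for v
    using that
  proof induction
    case (step y z)
    then have "{y, z} \<in> F" by simp
    then have "{y, z} \<subseteq> U \<or> {y, z} \<subseteq> L" using assms(2) by blast
    then show ?case using step.IH assms(3) by blast
  qed (rule assms(4))
  then show "{v. (u, v) \<in> {(x, y). {x, y} \<in> F}\<^sup>*} \<subseteq> U" by blast
qed

text \<open>Only the unordered pair of paths is determined, since the roles of \<open>U\<close> and
  \<open>L\<close> swap along the strip. The final claim is symmetric in the two paths.\<close>

lemma chain_graph_strip:
  assumes G: "chain_graph G" and two: "2 \<le> length (tiles G)"
    and col: "two_colouring G Bk Wh" and turns: "\<And>v. turn G v \<Longrightarrow> v \<in> Bk"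
  obtains U L b c n F where "strip Bk U L b c n (edges G) F" "U \<union> L = verts G"
    "{sw_path G, other_path G} = {U, L}"
proof -
  let ?ts = "tiles G" and ?N = "length (tiles G)"
  have chain: "tile_chain ?ts" and Gv: "verts G = tiles_verts ?ts" and Ge: "edges G = tiles_edges ?ts"
    using G by (auto simp: chain_graph_def)
  note N = length_pos[OF chain two]
  have bip: "x \<in> Bk \<longleftrightarrow> y \<notin> Bk" if "{x, y} \<in> tiles_edges ?ts" for x y
  proof -
    have "\<forall>e\<in>tiles_edges ?ts. \<exists>p\<in>Bk. \<exists>q\<in>Wh. e = {p, q}" and disj: "Bk \<inter> Wh = {}"
      using col unfolding two_colouring_def Ge by - (elim conjE, assumption)+
    from bspec[OF this(1) that] obtain p q where "p \<in> Bk" "q \<in> Wh" "{x, y} = {p, q}"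
      by (elim bexE)
    moreover have "q \<notin> Bk" using disj \<open>q \<in> Wh\<close> by blast
    ultimately show ?thesis by (auto simp: doubleton_eq_iff)
  qed
  \<comment> \<open>Such a vertex belongs to the tiles \<open>k - 1\<close>, \<open>k\<close> and
    \<open>Suc k\<close>, so it is a turn of the first kind.\<close>
  have pivot: "v \<in> Bk" if "k < ?N" "v \<in> crossing ?ts k" "v \<in> crossing ?ts (Suc k)" for k v
  proof -
    note T = three_tiles_at_pivot[OF chain two that]
    have "{k - 1, k, Suc k} \<subseteq> {i. i < ?N \<and> v \<in> set_tile (?ts ! i)}"
      using T by auto
    then have "card {k - 1, k, Suc k} \<le> num_tiles_at G v"
      unfolding num_tiles_at_def by (intro card_mono) auto
    moreover have "card {k - 1, k, Suc k} = 3" using T(1) by (auto simp: card_insert_if)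
    ultimately show ?thesis using turns[of v] by (simp add: turn_def)
  qed
  have "\<exists>U L b c n. strip Bk U L b c n (insert (crossing ?ts 0) (tiles_edges (take ?N ?ts)))
      (\<Union>i<?N. tile_edges (?ts ! i) - {crossing ?ts i, crossing ?ts (Suc i)}) \<and>
    {b, c} = crossing ?ts ?N \<and> U \<union> L = crossing ?ts 0 \<union> tiles_verts (take ?N ?ts)"
    by (rule tile_chain_strip[OF chain two bip pivot order_refl])
  then obtain U L b c n where
    s: "strip Bk U L b c n (insert (crossing ?ts 0) (tiles_edges (take ?N ?ts)))
      (\<Union>i<?N. tile_edges (?ts ! i) - {crossing ?ts i, crossing ?ts (Suc i)})"
    and bc: "{b, c} = crossing ?ts ?N" and V: "U \<union> L = crossing ?ts 0 \<union> tiles_verts (take ?N ?ts)"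
    by (elim exE conjE) (rule that)
  define F where "F = (\<Union>i<?N. tile_edges (?ts ! i) - {crossing ?ts i, crossing ?ts (Suc i)})"
  have t0: "crossing ?ts 0 \<in> tile_edges (?ts ! 0)"
    using crossing_edges(1)[OF chain two N(1)] .
  then have "crossing ?ts 0 \<in> tiles_edges ?ts"
    using N(1) unfolding tiles_edges_def by (meson UN_I nth_mem)
  then have E: "insert (crossing ?ts 0) (tiles_edges (take ?N ?ts)) = edges G"
    unfolding Ge by auto
  have "crossing ?ts 0 \<subseteq> tiles_verts ?ts"
    using tile_edges_subset[OF t0] set_tile_subset_tiles_verts[OF nth_mem[OF N(1)]] by blast
  then have V: "U \<union> L = verts G" using V unfolding Gv by auto
  have s: "strip Bk U L b c n (edges G) F"
    using s unfolding E F_def .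
  note bd = strip_boundary[OF s]
  have se: "start_edge G = crossing ?ts 0" "end_edge G = crossing ?ts ?N"
    unfolding start_edge_def end_edge_def private_vertices_def
    using private_tile_vertices[OF chain two] by simp_all
  have outer: "outer_edges G = F \<union> {crossing ?ts 0, crossing ?ts ?N}"
    unfolding outer_edges_def Ge F_def by (rule edges_in_unique_tile[OF chain two])
  have path: "boundary_path_edges G = F"
    unfolding boundary_path_edges_def outer se
    using inner_boundary_not_ends[OF chain two] unfolding F_def[symmetric] by blast
  \<comment> \<open>The second path is defined as a complement within the vertices of the outer
    edges, so these must be seen to cover both \<open>U\<close> and \<open>L\<close>.\<close>
  have outer_verts: "\<Union>(outer_edges G) = U \<union> L"
  proof
    show "U \<union> L \<subseteq> \<Union>(outer_edges G)"
      using bd bc unfolding outer by auto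
    have "\<Union>(edges G) = U \<union> L" using strip_Union[OF s] .
    moreover have "outer_edges G \<subseteq> edges G" by (auto simp: outer_edges_def)
    ultimately show "\<Union>(outer_edges G) \<subseteq> U \<union> L" by blast
  qed
  have disj: "U \<inter> L = {}" using strip_disjoint[OF s] .
  have "sw (hd ?ts) \<in> verts G"
    unfolding Gv using set_tile_subset_tiles_verts[OF hd_in_set[OF N(2)]]
    by (auto simp: set_tile_corners)
  then have "sw_path G = U \<and> other_path G = L \<or> sw_path G = L \<and> other_path G = U"
    unfolding V[symmetric]
  proof
    assume "sw (hd ?ts) \<in> U"
    then have "sw_path G = U"
      unfolding sw_path_def path using bd disj by (intro connected_by_component) auto
    then show ?thesis using disj by (auto simp: other_path_def outer_verts)
  next
    assume "sw (hd ?ts) \<in> L"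
    then have "sw_path G = L"
      unfolding sw_path_def path using bd disj by (intro connected_by_component[where L = U]) auto
    then show ?thesis using disj by (auto simp: other_path_def outer_verts)
  qed
  then have "{sw_path G, other_path G} = {U, L}" by auto
  then show ?thesis by (rule that[OF s V])
qed


section \<open>Determinants of the boundary submatrices\<close>

lemma bipartite_gram:
  fixes G :: "'a tiled_graph"
  assumes "distinct ws" "B = bipartite_adjacency G w bs ws" "i < length bs" "j < length bs"
  shows "(B * transpose_mat B) $$ (i, j) = gram (edges G) w (set ws) (bs ! i) (bs ! j)"
proof -
  have "(B * transpose_mat B) $$ (i, j) =
      (\<Sum>k<length ws. adj (edges G) w (bs ! i) (ws ! k) * adj (edges G) w (bs ! j) (ws ! k))"
    using assms(3,4)
    by (simp add: assms(2) bipartite_adjacency_def adj_def scalar_prod_def lessThan_atLeast0)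
  also have "\<dots> = gram (edges G) w (set ws) (bs ! i) (bs ! j)"
    unfolding gram_def
    by (rule sum.reindex_bij_betw[OF bij_betw_nth[OF assms(1) refl refl],
          of "\<lambda>z. adj (edges G) w (bs ! i) z * adj (edges G) w (bs ! j) z"])
  finally show ?thesis .
qed

lemma perfect_matching_iff:
  assumes "\<Union>(edges G) \<subseteq> verts G"
  shows "{M. perfect_matching G M} = matchings (edges G) (verts G)"
  using assms unfolding perfect_matching_def matchings_def by blast

theorem theorem6p15:
  fixes H :: "(real \<times> real) tiled_graph"
    and Black White :: "(real \<times> real) set"
    and w :: "(real \<times> real) set \<Rightarrow> real"
    and bs ws :: "(real \<times> real) list"
    and B B1 B2 :: "real mat"
  assumes "generalised_snake_graph H"
    and "length (tiles H) \<ge> 2"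
    and "two_colouring H Black White"
    and "\<And>v. turn H v \<Longrightarrow> v \<in> Black"
    and "kasteleyn H w"
    and "distinct bs" "set bs = Black"
    and "distinct ws" "set ws = White"
    and "B = bipartite_adjacency H w bs ws"
    and "B1 = principal_submatrix (B * transpose_mat B) bs (upper_boundary H)"
    and "B2 = principal_submatrix (B * transpose_mat B) bs (lower_boundary H)"
  shows "\<bar>det B1\<bar> = \<bar>det B2\<bar> \<and> \<bar>det B1\<bar> = real (card {M. perfect_matching H M})"
proof -
  obtain U L b c n F where s: "strip Black U L b c n (edges H) F" and V: "U \<union> L = verts H"
    and paths: "{sw_path H, other_path H} = {U, L}"
    using chain_graph_strip[OF generalised_snake_graph_chain_graph[OF assms(1)] assms(2-4)] by blast
  have col: "Black \<union> White = verts H" "Black \<inter> White = {}"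
    using assms(3) by (auto simp: two_colouring_def)
  have w: "w e * w e = 1" if "e \<in> edges H" for e
  proof -
    have "w e \<in> {1, -1}" using assms(5) that unfolding kasteleyn_def by blast
    then show ?thesis by auto
  qed
  have dims: "dim_row (B * transpose_mat B) = length bs" "dim_col (B * transpose_mat B) = length bs"
    by (simp_all add: assms(10) bipartite_adjacency_def)
  have det: "det (principal_submatrix (B * transpose_mat B) bs P) =
      det_on (P \<inter> Black) (gram (edges H) w White)" for P
    using det_principal_submatrix[OF assms(6) bipartite_gram[OF assms(8,10)] dims, of P] assms(7,9)
    by simp
  have "finite White" "White \<inter> Black = {}" "U \<union> L - Black \<subseteq> White"
    using assms(9) col V by auto
  note main = strip_det_eq_card_matchings[OF s w this]
  have match: "{M. perfect_matching H M} = matchings (edges H) (U \<union> L)"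
    using perfect_matching_iff[of H] strip_Union[OF s] V by simp
  \<comment> \<open>The determinants themselves equal the number of matchings; being nonnegative,
    they agree with their absolute values.\<close>
  have count: "det (principal_submatrix (B * transpose_mat B) bs P) = card {M. perfect_matching H M}"
    if "P \<in> {U, L}" for P
    using main that unfolding det match by auto
  have "upper_boundary H \<in> {U, L}" "lower_boundary H \<in> {U, L}"
    unfolding paths[symmetric] by (auto simp: upper_boundary_def lower_boundary_def)
  then show ?thesis
    using assms(11,12) count by simp
qed

end
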